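(* Let $\tau$ and $\tau'$ be the target functions for four robots defined in the context, and let $\Phi=\{\tau\}$ and $\Phi'=\{\tau'\}$. Then $\alpha(\Phi)=\alpha(\Phi')=1$. The sets $\Phi$ and $\Phi'$ are compatible with respect to the fault-tolerant $(4,2)$-convergence problem to a line segment, but $\Phi\cup\Phi'$ is not.
   Context: Robot model (four robots). Robots $r_1,\dots,r_4$ are points in the plane $\mathbb{R}^2$, which carries a fixed right-handed global coordinate system $Z_0$. Time is discrete, $t=0,1,2,\dots$; $\mathbf{x}_t(r_i)$ is the position of $r_i$ at time $t$ in $Z_0$, and the configuration at $t$ is the multiset $P_t=\{\mathbf{x}_t(r_i):1\le i\le 4\}$. Robot $r_i$ has a local coordinate system $Z_i$, right-handed, with its own unit length and axis directions (arbitrary, fixed over time), whose origin is always the current position of $r_i$; $\gamma_i$ denotes the coordinate transformation from $Z_i$ to $Z_0$ (an orientation-preserving similarity with $\gamma_i((0,0))=\mathbf{x}_t(r_i)$ at time $t$). A target function for four robots assigns to every multiset $P$ of $4$ points of $\mathbb{R}^2$ an element of $\mathbb{R}^2\cup\{\bot\}$, with value $\bot$ if and only if $(0,0)\notin P$. Each robot $r_i$ is assigned a target function $\phi_i$. The scheduler is semi-synchronous: at each time $t$ an arbitrary subset of robots is activated; if a non-crashed $r_i$ is activated at $t$ then $\mathbf{x}_{t+1}(r_i)=\gamma_i(\phi_i(\gamma_i^{-1}(P_t)))$, otherwise $\mathbf{x}_{t+1}(r_i)=\mathbf{x}_t(r_i)$. The schedule is fair: every robot is activated infinitely often. A faulty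 robot may crash at an arbitrary time, after which it never moves again. The sequence $P_0,P_1,\dots$ is an execution. Scale. $CH(P)$ is the convex hull of $P$, $g(P)$ is the center of gravity of $P$ (with multiplicity), and $d*CH(P)=\{d\mathbf{x}+(1-d)g(P):\mathbf{x}\in CH(P)\}$ for $d\ge0$. $\alpha(\phi,P)$ is the smallest $d\ge 0$ with $\phi(P)\in d*CH(P)$ (and $0$ if $\phi(P)=\bot$; $\infty$ if there is no such $d$). $\alpha(\phi)=\sup_P\alpha(\phi,P)$ over all $4$-point multisets $P$, and $\alpha(\Phi)=\sup_{\phi\in\Phi}\alpha(\phi)$. Compatibility. A set $\Phi$ of target functions is compatible with respect to the fault-tolerant $(4,2)$-convergence problem to a line segment if, for every assignment of target functions from $\Phi$ to the four robots (different robots may get different ones), every choice of local coordinate systems, every initial configuration, every fair schedule and every pattern of crashes in which at most two robots are faulty, the convex hull $CH(P_t)$ of the positions of all robots (including faulty ones) converges as $t\to\infty$ to a line segment or a point, in such a way that for each endpoint of the segment (or the point) there is a robot that converges to it. Target functions. $\overline{P}$ is the set of distinct points of $P$. Condition $\Psi$: $P=\{\mathbf{p}_1,\mathbf{p}_2,\mathbf{p}_3,\mathbf{p}_4\}$ is (the vertex set of) a convex quadrilateral such that $\angle\mathbf{p}_1<\angle\mathbf{p}_2<\angle\mathbf{p}_3<\angle\mathbf{p}_4$, where $\angle\mathbf{p}_i$ is the angle of the quadrilateral at its vertex $\mathbf{p}_i$ (the labels need not follow the cyclic order on the boundary). For $P$ with $(0,0)\in P$: - if $|\overline{P}|\le2$,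 then $\tau(P)=\tau'(P)=(0,0)$; - if $P$ satisfies $\Psi$, then $\tau(P)=\mathbf{p}_1$ and $\tau'(P)=\mathbf{p}_4$; - otherwise $\tau(P)=\tau'(P)=g(P)$. *)

theory Defs
  imports "HOL-Analysis.Analysis" "HOL-Library.Multiset" "HOL-Library.Extended_Nat"
begin

type_synonym point = "real^2"

(* None plays the role of the undefined value "bottom". *)
type_synonym target_fun = "point multiset \<Rightarrow> point option"

definition target_function :: "target_fun \<Rightarrow> bool" where
  "target_function \<phi> \<longleftrightarrow> (\<forall>P. size P = 4 \<longrightarrow> (\<phi> P = None \<longleftrightarrow> 0 \<notin># P))"

definition CH :: "point multiset \<Rightarrow> point set" where
  "CH P = convex hull (set_mset P)"

definition gravity :: "point multiset \<Rightarrow> point" where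
  "gravity P = sum_mset P /\<^sub>R real (size P)"


subsection \<open>Scale\<close>

definition scaled_hull :: "real \<Rightarrow> point multiset \<Rightarrow> point set" where
  "scaled_hull d P = {d *\<^sub>R x + (1 - d) *\<^sub>R gravity P | x. x \<in> CH P}"

(* Whenever some d is admissible a least one exists, since CH P is compact and contains
   gravity P (for P nonempty). *)
definition alpha_at :: "target_fun \<Rightarrow> point multiset \<Rightarrow> ennreal" where
  "alpha_at \<phi> P =
     (case \<phi> P of
        None \<Rightarrow> 0
      | Some y \<Rightarrow>
          (if \<exists>d\<ge>0. y \<in> scaled_hull d P
           then ennreal (LEAST d. 0 \<le> d \<and> y \<in> scaled_hull d P)
           else \<infinity>))"

definition alpha :: "target_fun \<Rightarrow> ennreal" where
  "alpha \<phi> = (SUP P\<in>{P. size P = 4}. alpha_at \<phi> P)"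

definition alpha_set :: "target_fun set \<Rightarrow> ennreal" where
  "alpha_set \<Phi> = (SUP \<phi>\<in>\<Phi>. alpha \<phi>)"


subsection \<open>Executions\<close>

(* The robots are the four elements of the numeral type 4. *)
definition config :: "(4 \<Rightarrow> point) \<Rightarrow> point multiset" where
  "config X = image_mset X (mset_set UNIV)"

(* Transformation, to global coordinates, of a right-handed local system with origin p,
   unit length u and axis directions given by the columns of the rotation matrix R. *)
definition to_global :: "real \<Rightarrow> real^2^2 \<Rightarrow> point \<Rightarrow> point \<Rightarrow> point" where
  "to_global u R p y = p + u *\<^sub>R (R *v y)"

(* Robot i uses the target function \<phi> i, the unit length u i and the axis directions R i;
   act t is the set of robots activated at time t.  A faulty robot i does not move at any time
   t with crash i \<le> t; crash i = \<infinity> means that robot i is not faulty. *)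
definition execution ::
  "(4 \<Rightarrow> target_fun) \<Rightarrow> (4 \<Rightarrow> real) \<Rightarrow> (4 \<Rightarrow> real^2^2) \<Rightarrow> (nat \<Rightarrow> 4 set) \<Rightarrow> (4 \<Rightarrow> enat)
     \<Rightarrow> (nat \<Rightarrow> 4 \<Rightarrow> point) \<Rightarrow> bool" where
  "execution \<phi> u R act crash x \<longleftrightarrow>
     (\<forall>t i.
        let \<gamma> = to_global (u i) (R i) (x t i) in
        if i \<in> act t \<and> enat t < crash i
        then Some (x (Suc t) i) = map_option \<gamma> (\<phi> i (image_mset (inv \<gamma>) (config (x t))))
        else x (Suc t) i = x t i)"

definition fair :: "(nat \<Rightarrow> 4 set) \<Rightarrow> bool" where
  "fair act \<longleftrightarrow> (\<forall>i. \<exists>\<^sub>\<infinity>t. i \<in> act t)"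


subsection \<open>Convergence to a line segment\<close>

(* Only used for nonempty bounded sets, where both suprema are finite. *)
definition hausdorff_dist :: "point set \<Rightarrow> point set \<Rightarrow> real" where
  "hausdorff_dist S T = max (SUP x\<in>S. infdist x T) (SUP y\<in>T. infdist y S)"

(* The case a = b is convergence to a point. *)
definition converges_to_segment :: "(nat \<Rightarrow> 4 \<Rightarrow> point) \<Rightarrow> bool" where
  "converges_to_segment x \<longleftrightarrow>
     (\<exists>a b. (\<lambda>t. hausdorff_dist (CH (config (x t))) (closed_segment a b)) \<longlonglongrightarrow> 0 \<and>
            (\<exists>i. (\<lambda>t. x t i) \<longlonglongrightarrow> a) \<and> (\<exists>j. (\<lambda>t. x t j) \<longlonglongrightarrow> b))"

definition compatible :: "target_fun set \<Rightarrow> bool" where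
  "compatible \<Phi> \<longleftrightarrow>
     (\<forall>\<phi> u R act crash x.
        (\<forall>i. \<phi> i \<in> \<Phi>) \<and>
        (\<forall>i. u i > 0 \<and> rotation_matrix (R i)) \<and>
        fair act \<and>
        card {i. crash i \<noteq> \<infinity>} \<le> 2 \<and>
        execution \<phi> u R act crash x
        \<longrightarrow> converges_to_segment x)"


subsection \<open>The target functions\<close>

definition convex_quadrilateral :: "point set \<Rightarrow> bool" where
  "convex_quadrilateral S \<longleftrightarrow> card S = 4 \<and> (\<forall>p\<in>S. p extreme_point_of (convex hull S))"

definition angle :: "point \<Rightarrow> point \<Rightarrow> point \<Rightarrow> real" where
  "angle q p r = arccos (((q - p) \<bullet> (r - p)) / (norm (q - p) * norm (r - p)))"

(* The angle at the vertex p of the convex polygon with vertex set S, i.e. the angle between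
   the two sides that meet in p. *)
definition vertex_angle :: "point set \<Rightarrow> point \<Rightarrow> real" where
  "vertex_angle S p =
     (THE \<theta>. \<exists>q\<in>S. \<exists>r\<in>S. q \<noteq> r \<and>
        closed_segment p q edge_of (convex hull S) \<and>
        closed_segment p r edge_of (convex hull S) \<and>
        \<theta> = angle q p r)"

(* The labelling, if it exists, is determined by P because the inequalities are strict. *)
definition Psi_labelling ::
  "point multiset \<Rightarrow> point \<Rightarrow> point \<Rightarrow> point \<Rightarrow> point \<Rightarrow> bool" where
  "Psi_labelling P p1 p2 p3 p4 \<longleftrightarrow>
     P = {#p1, p2, p3, p4#} \<and>
     convex_quadrilateral (set_mset P) \<and>
     vertex_angle (set_mset P) p1 < vertex_angle (set_mset P) p2 \<and>
     vertex_angle (set_mset P) p2 < vertex_angle (set_mset P) p3 \<and>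
     vertex_angle (set_mset P) p3 < vertex_angle (set_mset P) p4"

definition Psi :: "point multiset \<Rightarrow> bool" where
  "Psi P \<longleftrightarrow> (\<exists>p1 p2 p3 p4. Psi_labelling P p1 p2 p3 p4)"

definition tau :: target_fun where
  "tau P =
     (if 0 \<notin># P then None
      else if card (set_mset P) \<le> 2 then Some 0
      else if Psi P then Some (THE p1. \<exists>p2 p3 p4. Psi_labelling P p1 p2 p3 p4)
      else Some (gravity P))"

definition tau' :: target_fun where
  "tau' P =
     (if 0 \<notin># P then None
      else if card (set_mset P) \<le> 2 then Some 0
      else if Psi P then Some (THE p4. \<exists>p1 p2 p3. Psi_labelling P p1 p2 p3 p4)
      else Some (gravity P))"

lemma target_function_tau: "target_function tau"
  by (simp add: target_function_def tau_def)

lemma target_function_tau': "target_function tau'"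
  by (simp add: target_function_def tau'_def)

lemma Psi_labelling_unique:
  assumes "Psi_labelling P p1 p2 p3 p4" "Psi_labelling P q1 q2 q3 q4"
  shows "q1 = p1 \<and> q2 = p2 \<and> q3 = p3 \<and> q4 = p4"
proof -
  have "P = {#p1, p2, p3, p4#}" "P = {#q1, q2, q3, q4#}"
    using assms unfolding Psi_labelling_def by blast+
  hence "set_mset {#q1, q2, q3, q4#} = set_mset {#p1, p2, p3, p4#}" by simp
  hence "{q1, q2, q3, q4} = {p1, p2, p3, p4}" by simp
  hence mem: "q1 \<in> {p1, p2, p3, p4}" "q2 \<in> {p1, p2, p3, p4}" "q3 \<in> {p1, p2, p3, p4}"
    "q4 \<in> {p1, p2, p3, p4}" by blast+
  define f where "f = vertex_angle (set_mset P)"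
  have "f p1 < f p2" "f p2 < f p3" "f p3 < f p4" "f q1 < f q2" "f q2 < f q3" "f q3 < f q4"
    using assms unfolding Psi_labelling_def f_def by blast+
  with mem show ?thesis by auto
qed

end

theory Submission
  imports Defs
begin

text \<open>
  Fix a direction in which the extent of the configuration does not shrink to zero.  Eventually there
  are always robots near both ends of the extent, while gravity moves land far away from the
  ends; so between two occurrences of \<open>\<Psi>\<close> at least one robot near each end rests.  A
  move under \<open>\<Psi>\<close> puts two robots at the same point, and a parity argument shows that gravity
  moves of two robots around two resting ones never lead from such a configuration to a convex
  quadrilateral.  Hence \<open>\<Psi>\<close> eventually fails forever.  From then on every moving robot
  leaves the ends, so some robot is faulty, and gravity moves contract the distances to the
  convex hull of the faulty robots.  This is independent of which vertex is selected
  under \<open>\<Psi>\<close>, provided that all robots select the same one.  With both target functions, a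
  robot at the smallest angle using \<open>\<tau>\<close> and a robot at the largest angle using \<open>\<tau>'\<close>
  stay put, and the two other robots may have crashed.
\<close>

subsection \<open>Similarities\<close>

text \<open>\<open>k\<close> is the square of the scaling ratio. Orientation is not recorded:
  angles, hulls and centers of gravity do not depend on it.\<close>

definition similarity :: "(point \<Rightarrow> point) \<Rightarrow> bool" where
  "similarity f \<longleftrightarrow>
     (\<exists>c L k. linear L \<and> k > 0 \<and> (\<forall>v w. L v \<bullet> L w = k * (v \<bullet> w)) \<and> f = (\<lambda>y. c + L y))"

lemma
  assumes "u > 0" "rotation_matrix R"
  shows inv_to_global: "inv (to_global u R p) = (\<lambda>y. (1 / u) *\<^sub>R (transpose R *v (y - p)))"
    and bij_to_global: "bij (to_global u R p)"
proof -
  define h where "h = (\<lambda>y. (1 / u) *\<^sub>R (transpose R *v (y - p)))"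
  have R: "transpose R ** R = mat 1" "R ** transpose R = mat 1"
    using assms(2) unfolding rotation_matrix_def orthogonal_matrix_def by auto
  have 1: "to_global u R p (h y) = y" for y
    using assms(1) R
    by (simp add: h_def to_global_def matrix_vector_mult_scaleR matrix_vector_mul_assoc
        del: transpose_matrix_vector)
  have 2: "h (to_global u R p y) = y" for y
    using assms(1) R
    by (simp add: h_def to_global_def matrix_vector_mult_scaleR matrix_vector_mul_assoc
        del: transpose_matrix_vector)
  show "inv (to_global u R p) = (\<lambda>y. (1 / u) *\<^sub>R (transpose R *v (y - p)))"
    using inv_equality[OF 2 1] unfolding h_def .
  show "bij (to_global u R p)"
    by (rule o_bij[of h]) (auto simp: fun_eq_iff 1 2)
qed

lemma similarity_scaled_orthogonal:
  assumes "u > 0" "orthogonal_matrix R"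
  shows "similarity (\<lambda>y. c + u *\<^sub>R (R *v y))"
  unfolding similarity_def
proof (intro exI conjI allI)
  show "linear (\<lambda>y. u *\<^sub>R (R *v y))"
    by (intro linear_compose_scale_right matrix_vector_mul_linear)
  show "(u *\<^sub>R (R *v v)) \<bullet> (u *\<^sub>R (R *v w)) = u\<^sup>2 * (v \<bullet> w)" for v w
    using assms orthogonal_transformation_matrix[of "(*v) R"]
    by (simp add: orthogonal_transformation_def power2_eq_square)
qed (use assms in auto)

lemma similarity_to_global:
  assumes "u > 0" "rotation_matrix R"
  shows "similarity (to_global u R p)"
  using assms similarity_scaled_orthogonal[of u R p]
  unfolding rotation_matrix_def by (simp add: to_global_def[abs_def])

lemma similarity_inv_to_global:
  assumes "u > 0" "rotation_matrix R"
  shows "similarity (inv (to_global u R p))"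
proof -
  have "inv (to_global u R p) =
      (\<lambda>y. - ((1 / u) *\<^sub>R (transpose R *v p)) + (1 / u) *\<^sub>R (transpose R *v y))"
    by (simp add: inv_to_global[OF assms] matrix_vector_mult_diff_distrib scaleR_diff_right
        del: transpose_matrix_vector)
  moreover have "orthogonal_matrix (transpose R)"
    using assms(2) by (simp add: rotation_matrix_def)
  ultimately show ?thesis
    using assms(1) by (metis similarity_scaled_orthogonal zero_less_divide_1_iff)
qed

lemma similarity_inj:
  assumes "similarity f"
  shows "inj f"
proof -
  from assms obtain c L k where L: "linear L" "k > 0" "\<And>v w. L v \<bullet> L w = k * (v \<bullet> w)"
    "f = (\<lambda>y. c + L y)"
    unfolding similarity_def by blast
  have "v = 0" if "L v = 0" for v
    using L(2) L(3)[of v v] that by simp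
  then have "inj L"
    using L(1) linear_injective_0 by blast
  then show ?thesis
    by (auto simp: inj_def L(4))
qed

text \<open>The linear part multiplies the numerator and the denominator of the cosine by the same
  factor \<open>k\<close>.\<close>

lemma angle_similarity:
  assumes "similarity f"
  shows "angle (f q) (f p) (f r) = angle q p r"
proof -
  from assms obtain c L k where L: "linear L" "k > 0" "\<And>v w. L v \<bullet> L w = k * (v \<bullet> w)"
    "f = (\<lambda>y. c + L y)"
    unfolding similarity_def by blast
  have d: "f v - f w = L (v - w)" for v w
    using L(1) by (simp add: L(4) linear_diff)
  have n: "norm (L v) = sqrt k * norm v" for v
    by (simp add: norm_eq_sqrt_inner L(3) real_sqrt_mult)
  have s: "sqrt k * norm v * (sqrt k * norm w) = k * (norm v * norm w)" for v w :: point
    using L(2) by (metis less_eq_real_def mult.assoc mult.left_commute real_sqrt_mult_self abs_of_pos)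
  then show ?thesis
    using L(2) unfolding angle_def d n L(3) s by simp
qed

text \<open>Split into an injective linear map and a translation, both of which commute with hulls
  and preserve faces and affine dimension.\<close>

lemma edge_of_hull_similarity:
  assumes "similarity f"
  shows "closed_segment (f p) (f q) edge_of convex hull (f ` S) \<longleftrightarrow>
         closed_segment p q edge_of convex hull S"
proof -
  from assms obtain c L k where L: "linear L" "f = (\<lambda>y. c + L y)"
    unfolding similarity_def by blast
  have "inj L"
    using similarity_inj[OF assms] by (simp add: L(2) inj_def)
  have hull: "convex hull (f ` T) = (+) c ` (L ` (convex hull T))" for T
  proof -
    have "f ` T = (+) c ` (L ` T)"
      by (auto simp: L(2))
    then show ?thesis
      by (simp add: convex_hull_translation convex_hull_linear_image[OF L(1)])
  qed
  show ?thesis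
    using hull[of "{p, q}"] hull[of S] \<open>inj L\<close> L(1)
    by (simp add: edge_of_def segment_convex_hull face_of_linear_image aff_dim_translation_eq
        aff_dim_injective_linear_image)
qed

lemma vertex_angle_similarity:
  assumes "similarity f"
  shows "vertex_angle (f ` S) (f p) = vertex_angle S p"
  unfolding vertex_angle_def
  using similarity_inj[OF assms]
  by (simp add: edge_of_hull_similarity[OF assms] angle_similarity[OF assms] inj_eq)

lemma convex_quadrilateral_similarity:
  assumes "similarity f" "convex_quadrilateral S"
  shows "convex_quadrilateral (f ` S)"
proof -
  from assms obtain c L k where L: "linear L" "f = (\<lambda>y. c + L y)"
    unfolding similarity_def by blast
  have inj: "inj f" using similarity_inj[OF assms(1)] .
  then have "inj L"
    by (simp add: L(2) inj_def)
  have im: "f ` T = (+) c ` (L ` T)" for T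
    by (auto simp: L(2))
  have hull: "convex hull (f ` S) = (+) c ` (L ` (convex hull S))"
    unfolding im by (simp add: convex_hull_translation convex_hull_linear_image[OF L(1)])
  have "f p extreme_point_of convex hull (f ` S)" if "p \<in> S" for p
  proof -
    have "{p} face_of convex hull S"
      using assms(2) that by (auto simp: convex_quadrilateral_def face_of_singleton)
    then have "f ` {p} face_of convex hull (f ` S)"
      unfolding hull im[of "{p}"] by (simp add: face_of_linear_image L(1) \<open>inj L\<close> del: image_insert)
    then show ?thesis
      by (simp add: face_of_singleton)
  qed
  then show ?thesis
    using assms(2) inj by (auto simp: convex_quadrilateral_def card_image inj_on_def inj_def)
qed

lemma Psi_labelling_similarity:
  assumes "similarity f" "Psi_labelling P p1 p2 p3 p4"
  shows "Psi_labelling (image_mset f P) (f p1) (f p2) (f p3) (f p4)"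
  using assms(2) convex_quadrilateral_similarity[OF assms(1), of "set_mset P"]
  unfolding Psi_labelling_def multiset.set_map vertex_angle_similarity[OF assms(1)]
  by (metis image_mset_add_mset image_mset_empty)

lemma Psi_labelling_inv_similarity:
  assumes "similarity f" "similarity (inv f)" "bij f"
  shows "Psi_labelling (image_mset (inv f) P) q1 q2 q3 q4 \<longleftrightarrow>
         Psi_labelling P (f q1) (f q2) (f q3) (f q4)"
proof -
  have "image_mset f (image_mset (inv f) P) = P" "inv f (f q) = q" for q
    using assms(3) by (simp_all add: multiset.map_comp bij_is_surj bij_is_inj surj_iff[THEN iffD1])
  then show ?thesis
    using Psi_labelling_similarity[OF assms(1), of "image_mset (inv f) P" q1 q2 q3 q4]
      Psi_labelling_similarity[OF assms(2), of P "f q1" "f q2" "f q3" "f q4"]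
    by auto
qed

text \<open>The empty multiset is excluded because its \<open>gravity\<close> is the default
  \<open>0\<close>, which a translation does not respect.\<close>

lemma gravity_similarity:
  assumes "similarity f" "P \<noteq> {#}"
  shows "gravity (image_mset f P) = f (gravity P)"
proof -
  from assms obtain c L k where L: "linear L" "f = (\<lambda>y. c + L y)"
    unfolding similarity_def by blast
  have "sum_mset (image_mset f P) = real (size P) *\<^sub>R c + L (sum_mset P)"
    by (induction P) (simp_all add: L linear_0 linear_add algebra_simps)
  then show ?thesis
    using L(1) assms(2) by (simp add: gravity_def L(2) linear_scale scaleR_add_right)
qed

subsection \<open>The target functions in global coordinates\<close>

definition Psi_first :: "point multiset \<Rightarrow> point" where
  "Psi_first P = (THE p1. \<exists>p2 p3 p4. Psi_labelling P p1 p2 p3 p4)"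

definition Psi_last :: "point multiset \<Rightarrow> point" where
  "Psi_last P = (THE p4. \<exists>p1 p2 p3. Psi_labelling P p1 p2 p3 p4)"

lemma Psi_first_eq: "Psi_labelling P p1 p2 p3 p4 \<Longrightarrow> Psi_first P = p1"
  unfolding Psi_first_def by (rule the_equality) (use Psi_labelling_unique in blast)+

lemma Psi_last_eq: "Psi_labelling P p1 p2 p3 p4 \<Longrightarrow> Psi_last P = p4"
  unfolding Psi_last_def by (rule the_equality) (use Psi_labelling_unique in blast)+

lemma Psi_first_mem: "Psi P \<Longrightarrow> Psi_first P \<in># P"
  unfolding Psi_def using Psi_first_eq by (fastforce simp: Psi_labelling_def)

lemma Psi_last_mem: "Psi P \<Longrightarrow> Psi_last P \<in># P"
  unfolding Psi_def using Psi_last_eq by (fastforce simp: Psi_labelling_def)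

lemma Psi_convex_quadrilateral: "Psi P \<Longrightarrow> convex_quadrilateral (set_mset P)"
  unfolding Psi_def Psi_labelling_def by blast

text \<open>The common interface of \<open>tau\<close> and \<open>tau'\<close>: \<open>s\<close>
  picks the target vertex under \<open>Psi\<close>, among the points present and independently of
  the coordinate system. Scale and compatibility are derived from this alone.\<close>

definition selects :: "target_fun \<Rightarrow> (point multiset \<Rightarrow> point) \<Rightarrow> bool" where
  "selects \<phi> s \<longleftrightarrow>
     (\<forall>P. \<phi> P = (if 0 \<notin># P then None else if card (set_mset P) \<le> 2 then Some 0
                 else if Psi P then Some (s P) else Some (gravity P))) \<and>
     (\<forall>P. Psi P \<longrightarrow> s P \<in># P) \<and>
     (\<forall>f P. similarity f \<and> similarity (inv f) \<and> bij f \<and> Psi P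
        \<longrightarrow> f (s (image_mset (inv f) P)) = s P)"

lemma selects_tau: "selects tau Psi_first"
proof -
  have "f (Psi_first (image_mset (inv f) P)) = Psi_first P"
    if f: "similarity f" "similarity (inv f)" "bij f" and "Psi P" for f P
  proof -
    from \<open>Psi P\<close> obtain p1 p2 p3 p4 where P: "Psi_labelling P p1 p2 p3 p4"
      unfolding Psi_def by blast
    have "f (inv f p) = p" for p
      using f(3) by (simp add: bij_is_surj surj_f_inv_f)
    then show ?thesis
      using Psi_first_eq[OF P] Psi_first_eq[OF Psi_labelling_similarity[OF f(2) P]] by simp
  qed
  then show ?thesis
    by (auto simp: selects_def tau_def Psi_first_def[symmetric] Psi_first_mem)
qed

lemma selects_tau': "selects tau' Psi_last"
proof -
  have "f (Psi_last (image_mset (inv f) P)) = Psi_last P"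
    if f: "similarity f" "similarity (inv f)" "bij f" and "Psi P" for f P
  proof -
    from \<open>Psi P\<close> obtain p1 p2 p3 p4 where P: "Psi_labelling P p1 p2 p3 p4"
      unfolding Psi_def by blast
    have "f (inv f p) = p" for p
      using f(3) by (simp add: bij_is_surj surj_f_inv_f)
    then show ?thesis
      using Psi_last_eq[OF P] Psi_last_eq[OF Psi_labelling_similarity[OF f(2) P]] by simp
  qed
  then show ?thesis
    by (auto simp: selects_def tau'_def Psi_last_def[symmetric] Psi_last_mem)
qed

text \<open>Local coordinates drop out: every branch of \<open>\<phi>\<close> commutes with
  similarities, and the local origin is the robot's own position \<open>p\<close>.\<close>

lemma selects_global:
  assumes "selects \<phi> s" "u > 0" "rotation_matrix R" "p \<in># P"
  defines "f \<equiv> to_global u R p"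
  shows "map_option f (\<phi> (image_mset (inv f) P)) =
    Some (if card (set_mset P) \<le> 2 then p else if Psi P then s P else gravity P)"
proof -
  have f: "similarity f" "similarity (inv f)" "bij f"
    using assms by (simp_all add: similarity_to_global similarity_inv_to_global bij_to_global)
  have "inv f p = 0" and f0: "f 0 = p"
    using assms(2,3) unfolding f_def
    by (simp_all add: inv_to_global) (simp add: to_global_def)
  then have 0: "0 \<in># image_mset (inv f) P"
    using assms(4) by (metis image_eqI multiset.set_map)
  have card: "card (set_mset (image_mset (inv f) P)) = card (set_mset P)"
    using similarity_inj[OF f(2)] by (simp add: card_image inj_on_def inj_def)
  have surj: "f (inv f q) = q" for q
    using f(3) by (simp add: bij_is_surj surj_f_inv_f)
  have Psi: "Psi (image_mset (inv f) P) \<longleftrightarrow> Psi P"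
    unfolding Psi_def Psi_labelling_inv_similarity[OF f] using surj by metis
  have g: "f (gravity (image_mset (inv f) P)) = gravity P"
    using gravity_similarity[OF f(2), of P] assms(4) surj by fastforce
  have s: "f (s (image_mset (inv f) P)) = s P" if "Psi P"
    using assms(1) f that unfolding selects_def by blast
  show ?thesis
    using assms(1) 0 card unfolding selects_def by (auto simp: Psi f0 g s)
qed

subsection \<open>Gravity moves around two resting robots\<close>

text \<open>Dropping \<open>y\<close> leaves the hull unchanged, and extreme points of the smaller
  description are among \<open>A\<close>, \<open>B\<close>, \<open>z\<close>. So \<open>y\<close> is
  extreme only if it coincides with one of these.\<close>

lemma not_convex_quadrilateral_if_in_hull:
  assumes "y \<in> convex hull {A, B, z}"
  shows "\<not> convex_quadrilateral {A, B, y, z}"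
proof
  assume q: "convex_quadrilateral {A, B, y, z}"
  have "convex hull {A, B, y, z} = convex hull {A, B, z}"
    using assms hull_redundant[of y convex "{A, B, z}"] by (simp add: insert_commute)
  moreover have "y extreme_point_of convex hull {A, B, y, z}"
    using q by (simp add: convex_quadrilateral_def)
  ultimately have "y \<in> {A, B, z}"
    using extreme_point_of_convex_hull by metis
  then have "card {A, B, y, z} \<le> 3"
    by (auto simp: card_insert_if)
  with q show False
    by (simp add: convex_quadrilateral_def)
qed

text \<open>At relative height \<open>\<theta> = q / q'\<close> the triangle over the base from
  \<open>m - a\<close> to \<open>m + a\<close> has a section centered at
  \<open>\<theta> * p'\<close> with half-width \<open>1 - \<theta>\<close>, measured along
  \<open>a\<close>. The determinant bound says exactly that \<open>p\<close> falls into this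
  section.\<close>

lemma in_hull_of_base_and_apex:
  fixes m a v :: point
  assumes "0 \<le> q" "q < q'" "\<bar>p * q' - p' * q\<bar> \<le> q' - q"
  shows "m + p *\<^sub>R a + q *\<^sub>R v \<in> convex hull {m + a, m - a, m + p' *\<^sub>R a + q' *\<^sub>R v}"
proof -
  define \<theta> where "\<theta> = q / q'"
  define \<rho> where "\<rho> = p - \<theta> * p'"
  have q': "q' > 0" using assms by linarith
  have "\<theta> \<ge> 0" "\<theta> * q' = q"
    using assms q' by (simp_all add: \<theta>_def)
  have "\<rho> = (p * q' - p' * q) / q'" "1 - \<theta> = (q' - q) / q'"
    using q' by (simp_all add: \<rho>_def \<theta>_def field_simps)
  then have "\<bar>\<rho>\<bar> \<le> 1 - \<theta>"
    using assms(3) q' by (simp add: abs_divide divide_right_mono)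
  moreover have "m + p *\<^sub>R a + q *\<^sub>R v =
      ((1 - \<theta> + \<rho>) / 2) *\<^sub>R (m + a) + ((1 - \<theta> - \<rho>) / 2) *\<^sub>R (m - a)
        + \<theta> *\<^sub>R (m + p' *\<^sub>R a + q' *\<^sub>R v)"
    using \<open>\<theta> * q' = q\<close>
    by (simp add: vec_eq_iff \<rho>_def) (simp add: field_simps)
  moreover have "(1 - \<theta> + \<rho>) / 2 + (1 - \<theta> - \<rho>) / 2 + \<theta> = 1"
    by (simp add: field_simps)
  moreover have "0 \<le> (1 - \<theta> + \<rho>) / 2" "0 \<le> (1 - \<theta> - \<rho>) / 2"
    using calculation(1) by auto
  ultimately show ?thesis
    using \<open>\<theta> \<ge> 0\<close> unfolding convex_hull_3 mem_Collect_eq by blast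
qed

(* The two moving robots are m + p a + q v and m + p' a + q' v.  Both the determinant of the
   coefficients and c shrink by the factor 4 in each move, while Q + Q' stays odd, so that the
   heights q and q' differ by at least c.  By in_hull_of_base_and_apex this keeps the lower of
   the two robots inside the triangle spanned by the upper one and m + a, m - a. *)
definition odd_heights :: "point \<Rightarrow> point \<Rightarrow> point \<Rightarrow> point \<Rightarrow> bool" where
  "odd_heights m a y z \<longleftrightarrow>
     (\<exists>v c p p' Q Q'. c > 0 \<and> Q \<ge> 0 \<and> Q' \<ge> 0 \<and> odd (Q + Q' :: int) \<and>
        y = m + p *\<^sub>R a + (c * of_int Q) *\<^sub>R v \<and> z = m + p' *\<^sub>R a + (c * of_int Q') *\<^sub>R v \<and>
        \<bar>p * (c * of_int Q') - p' * (c * of_int Q)\<bar> \<le> c)"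

text \<open>The invariant for two moving robots on a common ray from the midpoint \<open>m\<close>
  of the resting ones. It covers coinciding robots, at the start or after a simultaneous
  move.\<close>

definition on_ray :: "point \<Rightarrow> point \<Rightarrow> point \<Rightarrow> bool" where
  "on_ray m y z \<longleftrightarrow> (\<exists>v p q. p \<ge> 0 \<and> q \<ge> 0 \<and> y = m + p *\<^sub>R v \<and> z = m + q *\<^sub>R v)"

lemma odd_heights_sym: "odd_heights m a y z \<Longrightarrow> odd_heights m a z y"
  unfolding odd_heights_def
  by (elim exE, rule_tac x = v in exI, rule_tac x = c in exI, rule_tac x = p' in exI,
      rule_tac x = p in exI, rule_tac x = Q' in exI, rule_tac x = Q in exI)
    (simp add: add.commute abs_minus_commute)

lemma on_ray_sym: "on_ray m y z \<Longrightarrow> on_ray m z y"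
  unfolding on_ray_def by blast

lemma on_ray_refl: "on_ray m y y"
  unfolding on_ray_def by (intro exI[of _ "y - m"] exI[of _ 1]) simp

text \<open>With \<open>v = z - m\<close> and \<open>c = 1\<close> the heights are 0 and 1, and the
  determinant has absolute value 1.\<close>

lemma odd_heights_start:
  assumes "y = m + a \<or> y = m - a"
  shows "odd_heights m a y z"
proof -
  obtain p :: real where p: "\<bar>p\<bar> = 1" "y = m + p *\<^sub>R a"
  proof (cases "y = m + a")
    case True
    then show ?thesis using that[of 1] by simp
  next
    case False
    then show ?thesis using assms that[of "-1"] by simp
  qed
  have "(1::real) > 0 \<and> (0::int) \<ge> 0 \<and> (1::int) \<ge> 0 \<and> odd (0 + 1 :: int) \<and>
      y = m + p *\<^sub>R a + (1 * of_int 0) *\<^sub>R (z - m) \<and>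
      z = m + 0 *\<^sub>R a + (1 * of_int 1) *\<^sub>R (z - m) \<and>
      \<bar>p * (1 * of_int 1) - 0 * (1 * of_int 0)\<bar> \<le> 1"
    using p by simp
  then show ?thesis
    unfolding odd_heights_def by blast
qed

text \<open>In the new unit \<open>c / 4\<close> the integer heights are \<open>Q + Q'\<close> and
  \<open>4 * Q'\<close>, whose sum is again odd. Adding one row to the other keeps the determinant,
  and the factor 1/4 shrinks it together with \<open>c\<close>.\<close>

lemma odd_heights_step:
  assumes "odd_heights m a y z"
  shows "odd_heights m a ((1/4) *\<^sub>R (2 *\<^sub>R m + y + z)) z"
proof -
  obtain v c p p' Q Q' where *: "c > 0" "Q \<ge> 0" "Q' \<ge> 0" "odd (Q + Q' :: int)"
    "y = m + p *\<^sub>R a + (c * of_int Q) *\<^sub>R v" "z = m + p' *\<^sub>R a + (c * of_int Q') *\<^sub>R v"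
    "\<bar>p * (c * of_int Q') - p' * (c * of_int Q)\<bar> \<le> c"
    using assms unfolding odd_heights_def by blast
  show ?thesis
    unfolding odd_heights_def
  proof (intro exI conjI)
    show "(1/4) *\<^sub>R (2 *\<^sub>R m + y + z) =
        m + ((p + p') / 4) *\<^sub>R a + ((c / 4) * of_int (Q + Q')) *\<^sub>R v"
      by (simp add: *(5,6) vec_eq_iff field_simps)
    show "z = m + p' *\<^sub>R a + ((c / 4) * of_int (4 * Q')) *\<^sub>R v"
      by (simp add: *(6))
    have "(p + p') / 4 * (c / 4 * of_int (4 * Q')) - p' * (c / 4 * of_int (Q + Q')) =
        (p * (c * of_int Q') - p' * (c * of_int Q)) / 4"
      by (simp add: field_simps)
    then show "\<bar>(p + p') / 4 * (c / 4 * of_int (4 * Q')) - p' * (c / 4 * of_int (Q + Q'))\<bar> \<le> c / 4"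
      using *(7) by (simp only: abs_divide) simp
  qed (use * in auto)
qed

lemma on_ray_step:
  assumes "on_ray m y z"
  shows "on_ray m ((1/4) *\<^sub>R (2 *\<^sub>R m + y + z)) z"
proof -
  obtain v p q where *: "p \<ge> 0" "q \<ge> 0" "y = m + p *\<^sub>R v" "z = m + q *\<^sub>R v"
    using assms unfolding on_ray_def by blast
  then have "(1/4) *\<^sub>R (2 *\<^sub>R m + y + z) = m + ((p + q) / 4) *\<^sub>R v"
    by (simp add: vec_eq_iff field_simps)
  with * show ?thesis
    unfolding on_ray_def by (metis add_nonneg_nonneg divide_nonneg_pos zero_less_numeral)
qed

lemma odd_heights_not_convex:
  assumes "odd_heights m a y z"
  shows "\<not> convex_quadrilateral {m + a, m - a, y, z}"
proof -
  obtain v c p p' Q Q' where *: "c > 0" "Q \<ge> 0" "Q' \<ge> 0" "odd (Q + Q' :: int)"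
    "y = m + p *\<^sub>R a + (c * of_int Q) *\<^sub>R v" "z = m + p' *\<^sub>R a + (c * of_int Q') *\<^sub>R v"
    "\<bar>p * (c * of_int Q') - p' * (c * of_int Q)\<bar> \<le> c"
    using assms unfolding odd_heights_def by blast
  \<comment> \<open>Parity makes the integer heights distinct, so the real heights differ by at
    least \<open>c\<close>, the bound on the determinant.\<close>
  have gap: "c \<le> c * of_int X - c * of_int Y" if "Y < X" for X Y :: int
  proof -
    have "c * 1 \<le> c * of_int (X - Y)"
      using that *(1) by (intro mult_left_mono) auto
    then show ?thesis by (simp add: algebra_simps)
  qed
  have "Q \<noteq> Q'" using *(4) by auto
  then consider "Q < Q'" | "Q' < Q" by linarith
  then show ?thesis
  proof cases
    case 1
    then have "y \<in> convex hull {m + a, m - a, z}"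
      unfolding *(5,6) using * gap[OF 1] by (intro in_hull_of_base_and_apex) auto
    then show ?thesis by (rule not_convex_quadrilateral_if_in_hull)
  next
    case 2
    then have "z \<in> convex hull {m + a, m - a, y}"
      unfolding *(5,6) using * gap[OF 2] by (intro in_hull_of_base_and_apex) auto
    then show ?thesis
      using not_convex_quadrilateral_if_in_hull[of z "m + a" "m - a" y] by (simp add: insert_commute)
  qed
qed

lemma on_ray_in_hull:
  assumes "0 \<le> p" "p \<le> q" "q > 0"
  shows "m + p *\<^sub>R v \<in> convex hull {m + a, m - a, m + q *\<^sub>R v :: point}"
  \<comment> \<open>Heights are measured along \<open>q *\<^sub>R v\<close>, which puts the apex at
    height 1. The case \<open>p = q\<close> is separate because the triangle lemma needs strictly
    different heights.\<close>
  using in_hull_of_base_and_apex[of "p / q" 1 0 0 m a "q *\<^sub>R v"] assms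
  by (cases "p = q") (auto intro: hull_inc)

lemma on_ray_not_convex:
  assumes "on_ray m y z"
  shows "\<not> convex_quadrilateral {m + a, m - a, y, z}"
proof -
  obtain v p q where *: "p \<ge> 0" "q \<ge> 0" "y = m + p *\<^sub>R v" "z = m + q *\<^sub>R v"
    using assms unfolding on_ray_def by blast
  consider "p \<le> q" "q > 0" | "q \<le> p" "p > 0" | "p = 0" "q = 0" 
    using * by linarith
  then show ?thesis
  proof cases
    case 1
    then show ?thesis
      using on_ray_in_hull[of p q m v a] *
      by (intro not_convex_quadrilateral_if_in_hull) auto
  next
    case 2
    then show ?thesis
      using on_ray_in_hull[of q p m v a] * not_convex_quadrilateral_if_in_hull[of z "m + a" "m - a" y]
      by (simp add: insert_commute)
  next
    case 3
    then have "y \<in> convex hull {m + a, m - a, z}"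
      using * by (auto intro: hull_inc)
    then show ?thesis by (rule not_convex_quadrilateral_if_in_hull)
  qed
qed

lemma other_two_robots:
  fixes r s :: 4
  assumes "r \<noteq> s"
  obtains y z where "y \<noteq> z" "y \<noteq> r" "y \<noteq> s" "z \<noteq> r" "z \<noteq> s" "UNIV = {r, s, y, z}"
proof -
  have "card (UNIV - {r, s}) = 2"
    using assms by (simp add: card_Diff_subset)
  then obtain y z where yz: "UNIV - {r, s} = {y, z}" "y \<noteq> z"
    by (auto simp: card_2_iff)
  then have "UNIV = {r, s, y, z}" "y \<noteq> r" "y \<noteq> s" "z \<noteq> r" "z \<noteq> s"
    by blast+
  with yz(2) that show ?thesis by blast
qed

lemma gravity_config: "gravity (config X) = (1 / 4) *\<^sub>R (\<Sum>i\<in>UNIV. X i)"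
  by (simp add: gravity_def config_def sum_unfold_sum_mset inverse_eq_divide)

lemma set_mset_config [simp]: "set_mset (config X) = range X"
  by (simp add: config_def)

text \<open>A coincidence at time 0 gives \<open>odd_heights\<close> or \<open>on_ray\<close> for
  the two robots other than \<open>r\<close> and \<open>s\<close>, and this disjunction survives
  every gravity move. If \<open>r\<close> and \<open>s\<close> themselves coincide, fewer than four
  points remain at time \<open>n\<close>.\<close>

proposition gravity_moves_not_convex:
  fixes x :: "nat \<Rightarrow> 4 \<Rightarrow> point"
  assumes rest: "r \<noteq> s" "\<And>u. u \<le> n \<Longrightarrow> x u r = x 0 r" "\<And>u. u \<le> n \<Longrightarrow> x u s = x 0 s"
    and moves: "\<And>u i. u < n \<Longrightarrow> x (Suc u) i \<in> {x u i, gravity (config (x u))}"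
    and coincide: "i \<noteq> j" "x 0 i = x 0 j"
  shows "\<not> convex_quadrilateral (range (x n))"
proof (cases "x 0 r = x 0 s")
  case True
  then have "\<not> inj (x n)"
    using rest(1) rest(2,3)[of n] by (metis injD order.refl)
  then have "card (range (x n)) \<noteq> 4"
    using eq_card_imp_inj_on[of "UNIV :: 4 set" "x n"] by auto
  then show ?thesis
    by (simp add: convex_quadrilateral_def)
next
  case False
  obtain y z where yz: "y \<noteq> z" "y \<noteq> r" "y \<noteq> s" "z \<noteq> r" "z \<noteq> s" and U: "UNIV = {r, s, y, z}"
    using other_two_robots[OF rest(1)] .
  define m where "m = (1/2) *\<^sub>R (x 0 r + x 0 s)"
  define a where "a = (1/2) *\<^sub>R (x 0 r - x 0 s)"
  have rs: "x 0 r = m + a" "x 0 s = m - a" "x 0 r + x 0 s = 2 *\<^sub>R m"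
    by (simp_all add: m_def a_def vec_eq_iff field_simps)
  have g: "gravity (config (x u)) = (1/4) *\<^sub>R (2 *\<^sub>R m + x u y + x u z)" if "u \<le> n" for u
    using yz rest(1) rest(2,3)[OF that] unfolding gravity_config U
    by (simp add: rs(3)[symmetric] add.assoc)
  let ?I = "\<lambda>y z. odd_heights m a y z \<or> on_ray m y z"
  have sym: "?I c b" if "?I b c" for b c
    using that odd_heights_sym on_ray_sym by blast
  have st: "?I ((1/4) *\<^sub>R (2 *\<^sub>R m + b + c)) c" if "?I b c" for b c
    using that odd_heights_step on_ray_step by blast
  have I: "?I (x u y) (x u z)" if "u \<le> n" for u
    using that
  proof (induction u)
    case 0
    \<comment> \<open>The coinciding pair is not \<open>r\<close> and \<open>s\<close>, so it
      contains a moving robot; the other one is either moving or resting.\<close>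
    have "{i, j} \<subseteq> {r, s, y, z}" using U by blast
    then consider "x 0 y = x 0 z" | "x 0 y = x 0 r \<or> x 0 y = x 0 s" | "x 0 z = x 0 r \<or> x 0 z = x 0 s"
      using coincide False by auto
    then show ?case
    proof cases
      case 1
      then show ?thesis using on_ray_refl by simp
    next
      case 2
      then show ?thesis using odd_heights_start rs by metis
    next
      case 3
      then show ?thesis using odd_heights_start odd_heights_sym rs by metis
    qed
  next
    case (Suc u)
    then have IH: "?I (x u y) (x u z)" and u: "u < n" "u \<le> n" by auto
    let ?g = "(1/4) *\<^sub>R (2 *\<^sub>R m + x u y + x u z)"
    have "?I ?g (x u z)"
      by (rule st[OF IH])
    moreover have "?I (x u y) ?g"
    proof -
      have "?g = (1/4) *\<^sub>R (2 *\<^sub>R m + x u z + x u y)"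
        by (simp add: add_ac)
      then show ?thesis using sym[OF st[OF sym[OF IH]]] by metis
    qed
    \<comment> \<open>When both move at once they meet, and meeting robots lie on a common
      ray.\<close>
    moreover have "?I ?g ?g"
      using on_ray_refl by blast
    moreover have "x (Suc u) y \<in> {x u y, ?g}" "x (Suc u) z \<in> {x u z, ?g}"
      using moves[OF u(1)] g[OF u(2)] by metis+
    ultimately show ?case
      using IH by auto
  qed
  have "range (x n) = {m + a, m - a, x n y, x n z}"
    using rest(2,3)[of n] unfolding U by (simp add: rs)
  then show ?thesis
    using I[of n] odd_heights_not_convex on_ray_not_convex by auto
qed

subsection \<open>Convergence\<close>

lemma hausdorff_dist_bounds:
  assumes "S \<noteq> {}" "T \<noteq> {}"
    and "\<And>p. p \<in> S \<Longrightarrow> infdist p T \<le> e" "\<And>q. q \<in> T \<Longrightarrow> infdist q S \<le> e"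
  shows "0 \<le> hausdorff_dist S T" "hausdorff_dist S T \<le> e"
proof -
  obtain p where p: "p \<in> S" using assms(1) by blast
  \<comment> \<open>The supremum dominates its terms only for sets bounded above.\<close>
  have "bdd_above ((\<lambda>p. infdist p T) ` S)"
    by (rule bdd_aboveI2[of _ _ e]) (rule assms(3))
  then have "infdist p T \<le> (SUP p\<in>S. infdist p T)"
    using p by (intro cSUP_upper)
  then show "0 \<le> hausdorff_dist S T"
    using infdist_nonneg[of p T] unfolding hausdorff_dist_def by linarith
  show "hausdorff_dist S T \<le> e"
    unfolding hausdorff_dist_def using assms by (auto intro!: cSUP_least)
qed

text \<open>Convex combinations of nearest points in \<open>K\<close> stay in \<open>K\<close>. This
  carries distance bounds from the robots over to their convex hull.\<close>

lemma convex_infdist_le: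
  fixes K :: "point set"
  assumes "convex K" "closed K" "K \<noteq> {}"
  shows "convex {p. infdist p K \<le> e}"
proof (rule convexI)
  fix p q :: point and u v :: real
  assume pq: "p \<in> {p. infdist p K \<le> e}" "q \<in> {p. infdist p K \<le> e}"
    and uv: "0 \<le> u" "0 \<le> v" "u + v = 1"
  obtain k where k: "k \<in> K" "infdist p K = dist p k"
    using infdist_attains_inf[OF assms(2,3)] by blast
  obtain l where l: "l \<in> K" "infdist q K = dist q l"
    using infdist_attains_inf[OF assms(2,3)] by blast
  have "u *\<^sub>R k + v *\<^sub>R l \<in> K"
    using assms(1) k l uv by (simp add: convex_def)
  moreover have "dist (u *\<^sub>R p + v *\<^sub>R q) (u *\<^sub>R k + v *\<^sub>R l) \<le> e"
  proof -
    have "dist (u *\<^sub>R p + v *\<^sub>R q) (u *\<^sub>R k + v *\<^sub>R l) = norm (u *\<^sub>R (p - k) + v *\<^sub>R (q - l))"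
      by (simp add: dist_norm algebra_simps)
    also have "\<dots> \<le> u * norm (p - k) + v * norm (q - l)"
      using uv by (intro order.trans[OF norm_triangle_ineq]) simp
    also have "\<dots> \<le> u * e + v * e"
      using uv pq k l by (intro add_mono mult_left_mono) (auto simp: dist_norm)
    also have "\<dots> = e"
      using uv by (metis distrib_right mult_1)
    finally show ?thesis .
  qed
  ultimately show "u *\<^sub>R p + v *\<^sub>R q \<in> {p. infdist p K \<le> e}"
    by (simp add: infdist_le2)
qed

text \<open>The average of the four nearest points lies in \<open>K\<close> and is compared with the
  average of the robots.\<close>

lemma infdist_average_le:
  fixes K :: "point set" and X :: "4 \<Rightarrow> point"
  assumes "convex K" "closed K" "K \<noteq> {}"
  shows "infdist (gravity (config X)) K \<le> (\<Sum>i\<in>UNIV. infdist (X i) K) / 4"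
proof -
  have "\<exists>k. k \<in> K \<and> infdist (X i) K = dist (X i) k" for i
    using infdist_attains_inf[OF assms(2,3)] by blast
  then obtain k where k: "\<And>i. k i \<in> K" "\<And>i. infdist (X i) K = dist (X i) (k i)"
    by metis
  have "(\<Sum>i\<in>UNIV. (1 / 4) *\<^sub>R k i) \<in> K"
    using k(1) by (intro convex_sum[OF _ assms(1)]) auto
  moreover have "dist (gravity (config X)) (\<Sum>i\<in>UNIV. (1 / 4) *\<^sub>R k i)
      \<le> (\<Sum>i\<in>UNIV. infdist (X i) K) / 4"
  proof -
    have "dist (gravity (config X)) (\<Sum>i\<in>UNIV. (1 / 4) *\<^sub>R k i) =
        norm ((1 / 4) *\<^sub>R (\<Sum>i\<in>UNIV. X i - k i))"
      by (simp add: dist_norm gravity_config scaleR_sum_right sum_subtractf scaleR_diff_right)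
    also have "\<dots> \<le> (1 / 4) * (\<Sum>i\<in>UNIV. norm (X i - k i))"
      by (simp add: norm_sum)
    finally show ?thesis
      by (simp add: k(2) dist_norm)
  qed
  ultimately show ?thesis
    by (rule infdist_le2)
qed

lemma CH_config: "CH (config X) = convex hull (range X)"
  by (simp add: CH_def)

text \<open>If the segment lies in every hull, only the distance from the hull to the segment has to
  be controlled. A degenerate segment need not lie in the hulls; there the robot converging to
  \<open>a\<close> bounds the other distance.\<close>

lemma converges_to_segmentI:
  assumes segment: "\<And>t. closed_segment a b \<subseteq> CH (config (x t)) \<or> a = b"
    and near: "\<And>e. e > 0 \<Longrightarrow> \<forall>\<^sub>F t in sequentially. \<forall>i. infdist (x t i) (closed_segment a b) \<le> e"
    and ends: "(\<lambda>t. x t i) \<longlonglongrightarrow> a" "(\<lambda>t. x t j) \<longlonglongrightarrow> b"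
  shows "converges_to_segment x"
proof -
  let ?K = "closed_segment a b"
  have "(\<lambda>t. hausdorff_dist (CH (config (x t))) ?K) \<longlonglongrightarrow> 0"
  proof (rule LIMSEQ_I)
    fix r :: real
    assume "r > 0"
    define e where "e = r / 2"
    have e: "e > 0" "e < r" using \<open>r > 0\<close> by (simp_all add: e_def)
    have "\<forall>\<^sub>F t in sequentially. dist (x t i) a < e"
      using ends(1) e(1) by (rule tendstoD)
    with near[OF e(1)]
    have "\<forall>\<^sub>F t in sequentially. norm (hausdorff_dist (CH (config (x t))) ?K - 0) < r"
    proof eventually_elim
      case (elim t)
      have H: "p \<in> CH (config (x t)) \<Longrightarrow> infdist p ?K \<le> e" for p
      proof -
        have "CH (config (x t)) \<subseteq> {p. infdist p ?K \<le> e}"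
          unfolding CH_config using elim(1)
          by (intro hull_minimal convex_infdist_le) auto
        then show "p \<in> CH (config (x t)) \<Longrightarrow> infdist p ?K \<le> e" by blast
      qed
      have K: "q \<in> ?K \<Longrightarrow> infdist q (CH (config (x t))) \<le> e" for q
      proof (cases "a = b")
        case True
        assume "q \<in> ?K"
        then have "q = a" using True by simp
        moreover have "x t i \<in> CH (config (x t))"
          by (simp add: CH_config hull_inc)
        ultimately show ?thesis
          using elim(2) by (intro infdist_le2[of "x t i"]) (auto simp: dist_commute)
      next
        case False
        assume "q \<in> ?K"
        then show ?thesis using segment[of t] False e(1) by (auto simp: subset_iff)
      qed
      have "CH (config (x t)) \<noteq> {}"
        by (simp add: CH_config)
      with hausdorff_dist_bounds[of "CH (config (x t))" ?K e, OF _ _ H K] e(2)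
      show ?case by simp
    qed
    then show "\<exists>no. \<forall>t\<ge>no. norm (hausdorff_dist (CH (config (x t))) ?K - 0) < r"
      by (simp add: eventually_sequentially)
  qed
  with ends show ?thesis
    unfolding converges_to_segment_def by blast
qed

lemma converges_to_segment_offset:
  assumes "converges_to_segment (\<lambda>t. x (t + n))"
  shows "converges_to_segment x"
proof -
  obtain a b i j where
    "(\<lambda>t. hausdorff_dist (CH (config (x (t + n)))) (closed_segment a b)) \<longlonglongrightarrow> 0"
    "(\<lambda>t. x (t + n) i) \<longlonglongrightarrow> a" "(\<lambda>t. x (t + n) j) \<longlonglongrightarrow> b"
    using assms unfolding converges_to_segment_def by blast
  then have "(\<lambda>t. hausdorff_dist (CH (config (x t))) (closed_segment a b)) \<longlonglongrightarrow> 0"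
    "(\<lambda>t. x t i) \<longlonglongrightarrow> a" "(\<lambda>t. x t j) \<longlonglongrightarrow> b"
    using LIMSEQ_offset[of "\<lambda>t. hausdorff_dist (CH (config (x t))) (closed_segment a b)" n]
      LIMSEQ_offset[of "\<lambda>t. x t i" n] LIMSEQ_offset[of "\<lambda>t. x t j" n] by blast+
  then show ?thesis
    unfolding converges_to_segment_def by blast
qed

section \<open>The dynamics after the last crash, in global coordinates\<close>

locale robot_dynamics =
  fixes x :: "nat \<Rightarrow> 4 \<Rightarrow> point" and moving :: "nat \<Rightarrow> 4 set" and faulty :: "4 set"
    and s :: "point multiset \<Rightarrow> point"
  assumes idle: "i \<notin> moving t \<Longrightarrow> x (Suc t) i = x t i"
    and move: "i \<in> moving t \<Longrightarrow> x (Suc t) i =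
      (if card (range (x t)) \<le> 2 then x t i
       else if Psi (config (x t)) then s (config (x t)) else gravity (config (x t)))"
    and select: "Psi P \<Longrightarrow> s P \<in># P"
    and faulty_idle: "i \<in> faulty \<Longrightarrow> i \<notin> moving t"
    and fair_moving: "i \<notin> faulty \<Longrightarrow> \<exists>u\<ge>t. i \<in> moving u"
    and few_faulty: "card faulty \<le> 2"
begin

lemma rest_or_gravity:
  "\<not> Psi (config (x t)) \<Longrightarrow> x (Suc t) i \<in> {x t i, gravity (config (x t))}"
  using idle move by (cases "i \<in> moving t") auto

lemma in_range_or_gravity: "x (Suc t) i \<in> insert (gravity (config (x t))) (range (x t))"
  using idle move select[of "config (x t)"] by (cases "i \<in> moving t") auto

text \<open>With at most two distinct points every robot stays, so the configuration is constant
  from then on.\<close>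

lemma converges_if_two_points:
  assumes "card (range (x t)) \<le> 2"
  shows "converges_to_segment x"
proof (rule converges_to_segment_offset)
  have const: "x (u + t) = x t" for u
  proof (induction u)
    case (Suc u)
    have "x (Suc (u + t)) i = x (u + t) i" for i
      using idle move assms Suc by (cases "i \<in> moving (u + t)") auto
    then show ?case
      using Suc by auto
  qed auto
  obtain i j where ij: "range (x t) = {x t i, x t j}"
  proof (cases "range (x t) = {x t 1}")
    case True
    then show ?thesis using that[of 1 1] by simp
  next
    case False
    then obtain j where "x t j \<noteq> x t 1" by blast
    then have "{x t 1, x t j} = range (x t)"
      using assms by (intro card_seteq) auto
    then show ?thesis using that by metis
  qed
  then have "CH (config (x t)) = closed_segment (x t i) (x t j)"
    by (simp add: CH_config segment_convex_hull)
  moreover from this have "x t k \<in> closed_segment (x t i) (x t j)" for k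
    by (metis CH_config hull_inc rangeI)
  ultimately show "converges_to_segment (\<lambda>u. x (u + t))"
    unfolding const by (intro converges_to_segmentI[of "x t i" "x t j" _ i j]) auto
qed

subsection \<open>The extent in a direction\<close>

text \<open>The support function of the configuration. The minimum in direction \<open>v\<close> is
  \<open>- extent (- v) t\<close>, so \<open>extent v t + extent (- v) t\<close> is the
  width.\<close>

definition extent :: "point \<Rightarrow> nat \<Rightarrow> real" where
  "extent v t = Max (range (\<lambda>i. v \<bullet> x t i))"

lemma extent_ge: "v \<bullet> x t i \<le> extent v t"
  by (simp add: extent_def)

lemma extent_attained: "\<exists>i. v \<bullet> x t i = extent v t"
  using Max_in[of "range (\<lambda>i. v \<bullet> x t i)"] unfolding extent_def by fastforce

text \<open>One robot attains the minimum \<open>- extent (- v) t\<close>; the other three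
  contribute at most \<open>extent v t\<close> each.\<close>

lemma inner_gravity_le: "v \<bullet> gravity (config (x t)) \<le> (3 * extent v t - extent (- v) t) / 4"
proof -
  obtain i where i: "v \<bullet> x t i = - extent (- v) t"
    using extent_attained[of "- v" t] by (metis inner_minus_left minus_minus)
  have "(\<Sum>j\<in>UNIV - {i}. v \<bullet> x t j) \<le> (\<Sum>j\<in>UNIV - {i}. extent v t)"
    by (intro sum_mono extent_ge)
  then have "(\<Sum>j\<in>UNIV. v \<bullet> x t j) \<le> 3 * extent v t - extent (- v) t"
    by (simp add: sum.remove[of UNIV i] i card_Diff_singleton)
  then show ?thesis
    by (simp add: gravity_config inner_sum_right)
qed

lemma extent_lower: "- extent (- v) t \<le> extent v t"
  using extent_ge[of v t 1] extent_ge[of "- v" t 1] by simp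

text \<open>Every new position is an old position or the center of gravity, also under
  \<open>Psi\<close>, so the hull never grows.\<close>

lemma decseq_extent: "decseq (extent v)"
proof (rule decseq_SucI)
  fix t
  obtain i where i: "v \<bullet> x (Suc t) i = extent v (Suc t)"
    using extent_attained by blast
  have "v \<bullet> gravity (config (x t)) \<le> extent v t"
    using inner_gravity_le[of v t] extent_lower[of v t] by argo
  then have "v \<bullet> x (Suc t) i \<le> extent v t"
    using in_range_or_gravity[of t i] extent_ge[of v t] by auto
  then show "extent v (Suc t) \<le> extent v t"
    by (simp add: i)
qed

lemma extent_limit: "\<exists>a. extent v \<longlonglongrightarrow> a \<and> (\<forall>t. a \<le> extent v t)"
proof -
  have "- extent (- v) 0 \<le> extent v t" for t
    using extent_lower[of v t] decseqD[OF decseq_extent, of 0 t "- v"] by linarith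
  then show ?thesis
    using decseq_convergent[OF decseq_extent] by metis
qed

text \<open>If the width tends to 0 in every direction, each coordinate is squeezed and all robots
  converge to one point. Hence a diverging execution has a direction whose width stays
  positive.\<close>

lemma converges_if_no_extent:
  assumes "\<And>v a b. extent v \<longlonglongrightarrow> a \<Longrightarrow> extent (- v) \<longlonglongrightarrow> b \<Longrightarrow> a + b \<le> 0"
  shows "converges_to_segment x"
proof -
  have "\<exists>c. extent v \<longlonglongrightarrow> c \<and> (\<lambda>t. - extent (- v) t) \<longlonglongrightarrow> c" for v
  proof -
    obtain a b where ab: "extent v \<longlonglongrightarrow> a" "extent (- v) \<longlonglongrightarrow> b"
      using extent_limit by blast
    have "- b \<le> a"
      using tendsto_le[OF _ ab(1) tendsto_minus[OF ab(2)]] extent_lower by auto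
    with assms[OF ab] have "b = - a" by linarith
    with ab show ?thesis using tendsto_minus[OF ab(2)] by auto
  qed
  then obtain c where c: "\<And>v. extent v \<longlonglongrightarrow> c v" "\<And>v. (\<lambda>t. - extent (- v) t) \<longlonglongrightarrow> c v"
    by metis
  \<comment> \<open>The limit point is assembled from the limits in the axis directions.\<close>
  define a :: point where "a = (\<chi> k. c (axis k 1))"
  have lim: "(\<lambda>t. x t i) \<longlonglongrightarrow> a" for i
  proof (rule vec_tendstoI)
    fix k
    have "- extent (- axis k 1) t \<le> x t i $ k" "x t i $ k \<le> extent (axis k 1) t" for t
      using extent_ge[of "- axis k 1" t i] extent_ge[of "axis k 1" t i]
      by (simp_all add: inner_commute[of "axis k 1"] inner_axis)
    then show "(\<lambda>t. x t i $ k) \<longlonglongrightarrow> a $ k"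
      unfolding a_def using c[of "axis k 1"]
      by (auto intro!: tendsto_sandwich[of "\<lambda>t. - extent (- axis k 1) t" _ _ "extent (axis k 1)"])
  qed
  show ?thesis
  proof (rule converges_to_segmentI[of a a x 1 1])
    fix e :: real
    assume "e > 0"
    have "\<forall>\<^sub>F t in sequentially. dist (x t i) a < e" for i
      using lim \<open>e > 0\<close> by (rule tendstoD)
    then have "\<forall>\<^sub>F t in sequentially. \<forall>i. dist (x t i) a < e"
      by (rule eventually_all_finite)
    then show "\<forall>\<^sub>F t in sequentially. \<forall>i. infdist (x t i) (closed_segment a a) \<le> e"
      by eventually_elim (auto intro: less_imp_le)
  qed (simp_all add: lim)
qed

text \<open>As soon as \<open>extent v t\<close> is below \<open>a + (a + b) / 8\<close>, the center
  of gravity is at most \<open>a - 5 * (a + b) / 32\<close> in direction \<open>v\<close>, while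
  some robot always stays at level \<open>a\<close> or above.\<close>

lemma extreme_robots:
  assumes "extent v \<longlonglongrightarrow> a" "extent (- v) \<longlonglongrightarrow> b" "a + b > 0"
  shows "\<forall>\<^sub>F t in sequentially. (\<exists>i. v \<bullet> x t i > a - (a + b) / 8) \<and>
           v \<bullet> gravity (config (x t)) \<le> a - (a + b) / 8"
proof -
  have "\<forall>\<^sub>F t in sequentially. extent v t < a + (a + b) / 8"
    using assms by (intro order_tendstoD(2)[OF assms(1)]) simp
  then show ?thesis
  proof eventually_elim
    case (elim t)
    have "a \<le> extent v t" "b \<le> extent (- v) t"
      using decseq_ge[OF decseq_extent] assms by blast+
    moreover obtain i where "v \<bullet> x t i = extent v t"
      using extent_attained by blast
    ultimately show ?case
      using elim inner_gravity_le[of v t] assms(3)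
      by (intro conjI exI[of _ i]) (auto simp: field_simps)
  qed
qed

section \<open>Resting extreme robots and the end of \<open>\<Psi>\<close>\<close>

lemma rest_away_from_gravity:
  assumes "x t i \<in> N"
    and "\<And>u. n \<le> u \<Longrightarrow> u < t \<Longrightarrow> \<not> Psi (config (x u)) \<and> gravity (config (x u)) \<notin> N"
    and "n \<le> u" "u \<le> t"
  shows "x u i = x t i"
  using assms
proof (induction t)
  case (Suc t)
  show ?case
  proof (cases "u = Suc t")
    case False
    then have u: "u \<le> t" "n \<le> t" using Suc.prems by auto
    then have "\<not> Psi (config (x t))" "gravity (config (x t)) \<notin> N"
      using Suc.prems(2)[of t] by auto
    \<comment> \<open>A gravity move would have put the robot outside \<open>N\<close>, so a robot
      now in \<open>N\<close> was already there.\<close>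
    then have "x (Suc t) i = x t i"
      using rest_or_gravity[of t i] Suc.prems(1) by auto
    then show ?thesis
      using Suc.IH Suc.prems u by simp
  qed simp
qed simp

text \<open>The move makes two robots coincide at time \<open>Suc n\<close>. As long as
  \<open>Psi\<close> has not recurred, the robots found in \<open>N\<close> and \<open>N'\<close> at
  time \<open>t\<close> have rested since then, so the parity argument applies to them.\<close>

lemma no_Psi_after_move:
  assumes Psi: "Psi (config (x n))" "x (Suc n) \<noteq> x n"
    and gravity: "\<And>t. t \<ge> n \<Longrightarrow> gravity (config (x t)) \<notin> N \<union> N'"
    and extreme: "\<And>t. t \<ge> n \<Longrightarrow> (\<exists>i. x t i \<in> N) \<and> (\<exists>i. x t i \<in> N')"
    and disjoint: "N \<inter> N' = {}"
    and "t > n"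
  shows "\<not> Psi (config (x t))"
  using \<open>t > n\<close>
proof (induction t rule: less_induct)
  case (less t)
  obtain i where i: "x (Suc n) i \<noteq> x n i"
    using Psi(2) by auto
  then have "i \<in> moving n" "\<not> card (range (x n)) \<le> 2"
    using idle move by fastforce+
  then have xi: "x (Suc n) i = s (config (x n))"
    using move Psi(1) by simp
  obtain j where j: "x n j = s (config (x n))"
    using select[OF Psi(1)] by auto
  \<comment> \<open>The robot at the selected vertex stays there whether activated or not, and
    \<open>i\<close> joins it.\<close>
  have "x (Suc n) j = s (config (x n))"
    using idle move[of j n] \<open>\<not> card (range (x n)) \<le> 2\<close> Psi(1) j by (cases "j \<in> moving n") auto
  with xi i j have coincide: "i \<noteq> j" "x (Suc n) i = x (Suc n) j"
    by auto
  obtain r q where rq: "x t r \<in> N" "x t q \<in> N'"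
    using extreme less.prems by (meson less_imp_le_nat)
  have noPsi: "\<not> Psi (config (x u))" if "Suc n \<le> u" "u < t" for u
    using less.IH that by auto
  have rest: "x u r = x t r" "x u q = x t q" if "Suc n \<le> u" "u \<le> t" for u
    using rest_away_from_gravity[OF rq(1) _ that] rest_away_from_gravity[OF rq(2) _ that]
      noPsi gravity by auto
  have "r \<noteq> q"
    using rq disjoint by auto
  \<comment> \<open>The time is written as \<open>t - Suc n + Suc n\<close> to match the execution
    restarted at \<open>Suc n\<close>.\<close>
  have "\<not> convex_quadrilateral (range (x (t - Suc n + Suc n)))"
  proof (rule gravity_moves_not_convex[where x = "\<lambda>u. x (u + Suc n)" and i = i and j = j,
        OF \<open>r \<noteq> q\<close>])
    show "x (u + Suc n) r = x (0 + Suc n) r" "x (u + Suc n) q = x (0 + Suc n) q"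
      if "u \<le> t - Suc n" for u
      using rest[of "u + Suc n"] rest[of "Suc n"] that less.prems by auto
    show "x (Suc u + Suc n) k \<in> {x (u + Suc n) k, gravity (config (x (u + Suc n)))}"
      if "u < t - Suc n" for u k
      using rest_or_gravity[of "u + Suc n" k] noPsi[of "u + Suc n"] that by simp
  qed (use coincide in auto)
  then show ?case
    using Psi_convex_quadrilateral[of "config (x t)"] less.prems by auto
qed

text \<open>At least two robots are nonfaulty and share the target \<open>s (config (x n))\<close>.
  In a permanent standstill both would already be there, although the four points are
  distinct.\<close>

lemma Psi_move:
  assumes "Psi (config (x n))"
  obtains t where "t \<ge> n" "Psi (config (x t))" "x (Suc t) \<noteq> x t"
proof -
  have "\<exists>t\<ge>n. x (Suc t) \<noteq> x t"
  proof (rule ccontr)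
    assume "\<not> (\<exists>t\<ge>n. x (Suc t) \<noteq> x t)"
    then have eq: "x (Suc t) = x t" if "t \<ge> n" for t
      using that by blast
    have const: "x t = x n" if "t \<ge> n" for t
      using that by (induction t rule: dec_induct) (auto simp: eq)
    have four: "card (range (x n)) = 4"
      using Psi_convex_quadrilateral[OF assms] by (simp add: convex_quadrilateral_def)
    then have "inj (x n)"
      by (intro eq_card_imp_inj_on) auto
    have target: "x n i = s (config (x n))" if "i \<notin> faulty" for i
    proof -
      obtain u where "u \<ge> n" "i \<in> moving u"
        using fair_moving \<open>i \<notin> faulty\<close> by blast
      then show ?thesis
        using move[of i u] eq[of u] const[of u] four assms by simp
    qed
    have "card (UNIV - faulty) \<ge> 2"
      using few_faulty card_Diff_subset[of faulty UNIV] by simp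
    then obtain T where "T \<subseteq> UNIV - faulty" "card T = 2"
      by (rule obtain_subset_with_card_n)
    then obtain i j where "i \<notin> faulty" "j \<notin> faulty" "i \<noteq> j"
      by (auto simp: card_2_iff)
    then show False
      using target[of i] target[of j] \<open>inj (x n)\<close> by (metis injD)
  qed
  then have *: "\<exists>d. x (Suc (n + d)) \<noteq> x (n + d)"
    by (metis le_Suc_ex)
  \<comment> \<open>Up to the first move the configuration is unchanged, so \<open>Psi\<close> still
    holds when it happens.\<close>
  define d where "d = (LEAST d. x (Suc (n + d)) \<noteq> x (n + d))"
  have d: "x (Suc (n + d)) \<noteq> x (n + d)"
    unfolding d_def using * by (rule LeastI_ex)
  have "x (n + u) = x n" if "u \<le> d" for u
    using that
  proof (induction u)
    case (Suc u)
    then have "x (Suc (n + u)) = x (n + u)"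
      using not_less_Least[of u "\<lambda>d. x (Suc (n + d)) \<noteq> x (n + d)"] unfolding d_def by simp
    then show ?case using Suc by simp
  qed simp
  then have "x (n + d) = x n" by simp
  then show ?thesis
    using that[of "n + d"] d assms by simp
qed

section \<open>Contraction towards the faulty robots\<close>

lemma infdist_contraction:
  assumes "convex K" "closed K"
    and gravity_only: "\<And>t. t \<ge> n \<Longrightarrow> \<not> Psi (config (x t)) \<and> card (range (x t)) > 2"
    and faulty: "faulty \<noteq> {}" "\<And>t i. t \<ge> n \<Longrightarrow> i \<in> faulty \<Longrightarrow> x t i \<in> K"
    and D: "\<And>i. infdist (x n i) K \<le> D"
  shows "\<exists>n'\<ge>n. \<forall>t\<ge>n'. \<forall>i. infdist (x t i) K \<le> 3 / 4 * D"
proof -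
  obtain f where f: "f \<in> faulty" using faulty by blast
  have "K \<noteq> {}" using faulty(2)[OF _ f, of n] by auto
  have "D \<ge> 0" using D[of f] infdist_nonneg[of "x n f" K] by linarith
  have g: "infdist (gravity (config (x t))) K \<le> 3 / 4 * D"
    if "t \<ge> n" "\<And>i. infdist (x t i) K \<le> D" for t
  proof -
    \<comment> \<open>The faulty robot \<open>f\<close> has distance 0 to \<open>K\<close>, so the
      average distance is at most \<open>3 / 4 * D\<close>.\<close>
    have "(\<Sum>i\<in>UNIV - {f}. infdist (x t i) K) \<le> (\<Sum>i\<in>UNIV - {f}. D)"
      by (intro sum_mono that)
    then have "(\<Sum>i\<in>UNIV. infdist (x t i) K) \<le> 3 * D"
      using faulty(2)[OF that(1) f] by (simp add: sum.remove[of UNIV f] card_Diff_singleton)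
    then show ?thesis
      using infdist_average_le[OF assms(1,2) \<open>K \<noteq> {}\<close>, of "x t"] by linarith
  qed
  have le: "infdist (x t i) K \<le> D" if "t \<ge> n" for t i
    using that
  proof (induction t arbitrary: i rule: dec_induct)
    case (step t)
    then show ?case
      using rest_or_gravity[of t i] gravity_only[of t] g[of t] \<open>D \<ge> 0\<close> by fastforce
  qed (rule D)
  have "\<exists>u\<ge>n. \<forall>t\<ge>u. infdist (x t i) K \<le> 3 / 4 * D" for i
  proof (cases "i \<in> faulty")
    case True
    then show ?thesis
      using faulty(2) \<open>D \<ge> 0\<close> by (intro exI[of _ n]) auto
  next
    case False
    then obtain u where u: "u \<ge> n" "i \<in> moving u"
      using fair_moving by blast
    \<comment> \<open>The first activation after \<open>n\<close> brings the robot to a center of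
      gravity; afterwards it rests or moves to another one, and all of them satisfy the
      bound.\<close>
    have "infdist (x t i) K \<le> 3 / 4 * D" if "t \<ge> Suc u" for t
      using that
    proof (induction t rule: dec_induct)
      case base
      have "x (Suc u) i = gravity (config (x u))"
        using move[OF u(2)] gravity_only[OF u(1)] by simp
      then show ?case using g[OF u(1) le[OF u(1)]] by simp
    next
      case (step t)
      then have "t \<ge> n" using u by simp
      then show ?case
        using rest_or_gravity[of t i] gravity_only[of t] g[of t] le[of t] step by auto
    qed
    then show ?thesis using u(1) by (intro exI[of _ "Suc u"]) auto
  qed
  then obtain u where u: "\<And>i. u i \<ge> n" "\<And>i t. t \<ge> u i \<Longrightarrow> infdist (x t i) K \<le> 3 / 4 * D"
    by metis
  show ?thesis
  proof (intro exI conjI allI impI)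
    show "Max (range u) \<ge> n"
      using u(1)[of 1] Max_ge[of "range u" "u 1"] by (meson finite_imageI finite order_trans rangeI)
    show "infdist (x t i) K \<le> 3 / 4 * D" if "t \<ge> Max (range u)" for t i
      using u(2) that by simp
  qed
qed

text \<open>The limit is the segment between the faulty robots, which never move and hence keep it
  inside every hull. The distances of all robots to it decay geometrically.\<close>

lemma converges_if_gravity_only:
  assumes gravity_only: "\<And>t. t \<ge> n \<Longrightarrow> \<not> Psi (config (x t)) \<and> card (range (x t)) > 2"
    and faulty: "faulty \<noteq> {}"
  shows "converges_to_segment x"
proof -
  \<comment> \<open>A single faulty robot is covered by \<open>f = g\<close> and yields a
    point.\<close>
  have "\<exists>f g. faulty = {f, g}"
  proof -
    obtain f where "f \<in> faulty" using faulty by blast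
    show ?thesis
    proof (cases "faulty = {f}")
      case False
      then obtain g where "g \<in> faulty" "g \<noteq> f" using \<open>f \<in> faulty\<close> by blast
      then have "{f, g} = faulty"
        using few_faulty \<open>f \<in> faulty\<close> by (intro card_seteq) auto
      then show ?thesis by metis
    qed auto
  qed
  then obtain f g where fg: "faulty = {f, g}" by blast
  define K where "K = closed_segment (x 0 f) (x 0 g)"
  have const: "x t i = x 0 i" if "i \<in> faulty" for t i
    by (induction t) (auto simp: idle faulty_idle that)
  have inK: "x t i \<in> K" if "i \<in> faulty" for t i
    using const[OF that, of t] that unfolding fg K_def by auto
  define D where "D = Max (range (\<lambda>i. infdist (x n i) K))"
  have contract: "\<exists>n''\<ge>n'. \<forall>t\<ge>n''. \<forall>i. infdist (x t i) K \<le> 3 / 4 * C"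
    if "n' \<ge> n" "\<And>i. infdist (x n' i) K \<le> C" for n' C
    using that inK faulty gravity_only
    by (intro infdist_contraction) (auto simp: K_def intro: order_trans)
  have shrink: "\<exists>n'\<ge>n. \<forall>i. infdist (x n' i) K \<le> (3 / 4) ^ k * D" for k
  proof (induction k)
    case 0
    have "infdist (x n i) K \<le> D" for i by (simp add: D_def)
    then show ?case by auto
  next
    case (Suc k)
    then obtain n' where n': "n' \<ge> n" "\<And>i. infdist (x n' i) K \<le> (3 / 4) ^ k * D"
      by blast
    obtain n'' where "n'' \<ge> n'" "\<And>i. infdist (x n'' i) K \<le> 3 / 4 * ((3 / 4) ^ k * D)"
      using contract[OF n'] by blast
    then show ?case
      using n'(1) by (intro exI[of _ n'']) (simp add: mult.assoc)
  qed
  show ?thesis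
  proof (rule converges_to_segmentI)
    show "closed_segment (x 0 f) (x 0 g) \<subseteq> CH (config (x t)) \<or> x 0 f = x 0 g" for t
    proof -
      have "{x 0 f, x 0 g} \<subseteq> range (x t)"
        using const[of f t] const[of g t] fg by (metis empty_subsetI insertCI insert_subset rangeI)
      then show ?thesis
        unfolding CH_config segment_convex_hull by (blast intro: hull_mono[THEN subsetD])
    qed
    have "(\<lambda>t. x t f) = (\<lambda>t. x 0 f)" "(\<lambda>t. x t g) = (\<lambda>t. x 0 g)"
      using const fg by blast+
    then show "(\<lambda>t. x t f) \<longlonglongrightarrow> x 0 f" "(\<lambda>t. x t g) \<longlonglongrightarrow> x 0 g"
      by simp_all
    fix e :: real
    assume "e > 0"
    have "(\<lambda>k. 3 / 4 * ((3 / 4) ^ k * D)) \<longlonglongrightarrow> 3 / 4 * (0 * D)"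
      by (intro tendsto_intros LIMSEQ_realpow_zero) auto
    then have "\<forall>\<^sub>F k in sequentially. 3 / 4 * ((3 / 4) ^ k * D) < e"
      using \<open>e > 0\<close> by (intro order_tendstoD(2)) auto
    then obtain k where k: "3 / 4 * ((3 / 4) ^ k * D) < e"
      by (auto simp: eventually_sequentially)
    obtain n' where "n' \<ge> n" "\<And>i. infdist (x n' i) K \<le> (3 / 4) ^ k * D"
      using shrink by blast
    \<comment> \<open>\<open>shrink\<close> speaks of one time only; one more contraction gives a
      bound for all later times.\<close>
    then obtain n'' where "\<And>t i. t \<ge> n'' \<Longrightarrow> infdist (x t i) K \<le> 3 / 4 * ((3 / 4) ^ k * D)"
      using contract by meson
    then show "\<forall>\<^sub>F t in sequentially. \<forall>i. infdist (x t i) (closed_segment (x 0 f) (x 0 g)) \<le> e"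
      using k unfolding eventually_sequentially K_def by (meson less_imp_le order_trans)
  qed
qed

text \<open>If every robot kept being activated, each would jump to a center of gravity outside
  \<open>N\<close> and never enter \<open>N\<close> again, leaving \<open>N\<close> empty.\<close>

lemma ex_faulty_if_extent:
  assumes gravity_only: "\<And>t. t \<ge> n \<Longrightarrow> \<not> Psi (config (x t)) \<and> card (range (x t)) > 2"
    and N: "\<And>t. t \<ge> n \<Longrightarrow> gravity (config (x t)) \<notin> N" "\<And>t. t \<ge> n \<Longrightarrow> \<exists>i. x t i \<in> N"
  shows "faulty \<noteq> {}"
proof
  assume "faulty = {}"
  have "\<exists>u. \<forall>t\<ge>u. x t i \<notin> N" for i
  proof -
    obtain u where u: "u \<ge> n" "i \<in> moving u"
      using fair_moving \<open>faulty = {}\<close> by blast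
    have "x t i \<notin> N" if "t \<ge> Suc u" for t
      using that
    proof (induction t rule: dec_induct)
      case base
      then show ?case
        using move[OF u(2)] gravity_only[OF u(1)] N(1)[OF u(1)] by simp
    next
      case (step t)
      then show ?case
        using rest_or_gravity[of t i] gravity_only[of t] N(1)[of t] u(1) by auto
    qed
    then show ?thesis by blast
  qed
  then obtain u where u: "\<And>i t. t \<ge> u i \<Longrightarrow> x t i \<notin> N"
    by metis
  define t where "t = max n (Max (range u))"
  have "x t i \<notin> N" for i
    by (rule u) (simp add: t_def le_max_iff_disj)
  moreover have "t \<ge> n"
    by (simp add: t_def)
  ultimately show False
    using N(2) by blast
qed

proposition converges: "converges_to_segment x"
proof (cases "\<exists>t. card (range (x t)) \<le> 2")
  case True
  then show ?thesis using converges_if_two_points by blast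
next
  case False
  then have many: "card (range (x t)) > 2" for t
    by (metis not_le)
  show ?thesis
  proof (rule ccontr)
    assume div: "\<not> ?thesis"
    then obtain v a b where v: "extent v \<longlonglongrightarrow> a" "extent (- v) \<longlonglongrightarrow> b" "a + b > 0"
      using converges_if_no_extent by (meson not_le)
    \<comment> \<open>\<open>N\<close> and \<open>N'\<close> are half-planes at the two ends of the
      limiting extent. Each reaches only \<open>(a + b) / 8\<close> inside, hence they are
      disjoint.\<close>
    define N where "N = {p. v \<bullet> p > a - (a + b) / 8}"
    define N' where "N' = {p. - v \<bullet> p > b - (b + a) / 8}"
    have "N \<inter> N' = {}"
      using v(3) by (auto simp: N_def N'_def field_simps)
    have "extent (- (- v)) \<longlonglongrightarrow> a"
      using v(1) by simp
    from eventually_conj[OF extreme_robots[OF v] extreme_robots[OF v(2) this]] v(3)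
    obtain n where n: "\<And>t. t \<ge> n \<Longrightarrow> gravity (config (x t)) \<notin> N \<union> N'"
      "\<And>t. t \<ge> n \<Longrightarrow> (\<exists>i. x t i \<in> N) \<and> (\<exists>i. x t i \<in> N')"
      unfolding eventually_sequentially N_def N'_def by (auto simp: add.commute not_less)
    have "\<exists>n'\<ge>n. \<forall>t\<ge>n'. \<not> Psi (config (x t))"
    proof (cases "\<exists>m\<ge>n. Psi (config (x m))")
      case True
      then obtain m where m: "m \<ge> n" "Psi (config (x m))" by blast
      obtain t where t: "t \<ge> m" "Psi (config (x t))" "x (Suc t) \<noteq> x t"
        using Psi_move[OF m(2)] .
      have "\<not> Psi (config (x u))" if "u > t" for u
        using m(1) t(1) n that by (intro no_Psi_after_move[OF t(2,3) _ _ \<open>N \<inter> N' = {}\<close>]) auto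
      then show ?thesis
        using m(1) t(1) by (intro exI[of _ "Suc t"]) auto
    qed blast
    then obtain n' where n': "n' \<ge> n" "\<And>t. t \<ge> n' \<Longrightarrow> \<not> Psi (config (x t))"
      by blast
    then have "faulty \<noteq> {}"
      using many n by (intro ex_faulty_if_extent[of n' N]) auto
    then show False
      using converges_if_gravity_only[of n'] n' many div by blast
  qed
qed

end

section \<open>From executions to the dynamics after the last crash\<close>

lemma compatible_singleton:
  assumes "selects \<phi> s"
  shows "compatible {\<phi>}"
  unfolding compatible_def
proof (intro allI impI, elim conjE)
  fix \<phi>' u R act crash x
  assume \<phi>': "\<forall>i. \<phi>' i \<in> {\<phi>}" and uR: "\<forall>i. u i > 0 \<and> rotation_matrix (R i)"
    and fair: "fair act" and card: "card {i. crash i \<noteq> \<infinity>} \<le> 2"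
    and ex: "execution \<phi>' u R act crash x"
  define F where "F = {i. crash i \<noteq> \<infinity>}"
  have "\<exists>n. crash i \<noteq> \<infinity> \<longrightarrow> crash i \<le> enat n" for i
    by (cases "crash i") auto
  then obtain c where c: "\<And>i. crash i \<noteq> \<infinity> \<Longrightarrow> crash i \<le> enat (c i)"
    by metis
  \<comment> \<open>Beyond all finite crash times, a robot is either crashed already or never
    crashes.\<close>
  define n where "n = Max (range c)"
  have alive: "enat (t + n) < crash i \<longleftrightarrow> i \<notin> F" for t i
  proof -
    have "c i \<le> n" by (simp add: n_def)
    then have "enat (c i) \<le> enat (t + n)" by simp
    then show ?thesis
      using c[of i] unfolding F_def by (cases "crash i") auto
  qed
  define moving where "moving t = act (t + n) - F" for t
  have step: "x (Suc t + n) i =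
      (if i \<in> moving t then
         (if card (range (x (t + n))) \<le> 2 then x (t + n) i
          else if Psi (config (x (t + n))) then s (config (x (t + n)))
          else gravity (config (x (t + n))))
       else x (t + n) i)" for t i
  proof -
    let ?\<gamma> = "to_global (u i) (R i) (x (t + n) i)"
    have ex': "if i \<in> act (t + n) \<and> enat (t + n) < crash i
        then Some (x (Suc (t + n)) i) =
          map_option ?\<gamma> (\<phi>' i (image_mset (inv ?\<gamma>) (config (x (t + n)))))
        else x (Suc (t + n)) i = x (t + n) i"
      using ex unfolding execution_def Let_def by (elim allE[of _ "t + n"] allE[of _ i])
    show ?thesis
    proof (cases "i \<in> moving t")
      case True
      have "\<phi>' i = \<phi>" using \<phi>' by simp
      then have "Some (x (Suc (t + n)) i) =
          map_option ?\<gamma> (\<phi> (image_mset (inv ?\<gamma>) (config (x (t + n)))))"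
        using ex' True alive[of t i] by (simp add: moving_def)
      also have "\<dots> = Some (if card (set_mset (config (x (t + n)))) \<le> 2 then x (t + n) i
          else if Psi (config (x (t + n))) then s (config (x (t + n)))
          else gravity (config (x (t + n))))"
        using uR by (intro selects_global[OF assms]) auto
      finally show ?thesis using True by simp
    next
      case False
      then have "\<not> (i \<in> act (t + n) \<and> enat (t + n) < crash i)"
        using alive[of t i] by (auto simp: moving_def)
      then have "x (Suc (t + n)) i = x (t + n) i"
        using ex' by (simp only: if_False)
      then show ?thesis using False by simp
    qed
  qed
  interpret robot_dynamics "\<lambda>t. x (t + n)" moving F s
  proof
    show "x (Suc t + n) i = x (t + n) i" if "i \<notin> moving t" for i t
      using step that by simp
    show "x (Suc t + n) i = (if card (range (x (t + n))) \<le> 2 then x (t + n) i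
          else if Psi (config (x (t + n))) then s (config (x (t + n)))
          else gravity (config (x (t + n))))" if "i \<in> moving t" for i t
      using step[of t i] that by simp
    show "s P \<in># P" if "Psi P" for P
      using assms that by (simp add: selects_def)
    show "i \<notin> moving t" if "i \<in> F" for i t
      using that by (simp add: moving_def)
    show "card F \<le> 2"
      using card by (simp add: F_def)
    fix i t
    assume "i \<notin> F"
    have "\<exists>\<^sub>\<infinity>t. i \<in> act t" using fair by (simp add: fair_def)
    then obtain m where "m \<ge> t + n" "i \<in> act m"
      by (auto simp: INFM_nat_le)
    \<comment> \<open>Time \<open>m\<close> of the execution is time \<open>m - n\<close> of the
      shifted dynamics.\<close>
    then show "\<exists>u\<ge>t. i \<in> moving u"
      using \<open>i \<notin> F\<close> by (intro exI[of _ "m - n"]) (auto simp: moving_def)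
  qed
  show "converges_to_segment x"
    using converges_to_segment_offset[OF converges] .
qed

subsection \<open>Scale\<close>

lemma gravity_in_CH:
  assumes "P \<noteq> {#}"
  shows "gravity P \<in> CH P"
  using assms
proof (induction P)
  case (add p P)
  show ?case
  proof (cases "P = {#}")
    case True
    then show ?thesis by (simp add: gravity_def CH_def)
  next
    case False
    define n where "n = real (size P)"
    have "n > 0" using False by (simp add: n_def nonempty_has_size)
    have "gravity P \<in> CH (add_mset p P)"
      using add.IH[OF False] hull_mono[of "set_mset P" "set_mset (add_mset p P)" convex]
      by (auto simp: CH_def)
    moreover have "p \<in> CH (add_mset p P)"
      by (simp add: CH_def hull_inc)
    \<comment> \<open>Adding a point makes the new center a convex combination of that point and the
      old center.\<close>
    moreover have "gravity (add_mset p P) = (1 / (n + 1)) *\<^sub>R p + (n / (n + 1)) *\<^sub>R gravity P"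
      using \<open>n > 0\<close>
      by (simp add: gravity_def n_def[symmetric] add.commute scaleR_add_right inverse_eq_divide)
    moreover have "convex (CH (add_mset p P))"
      by (simp add: CH_def)
    ultimately show ?thesis
      using \<open>n > 0\<close> by (auto intro!: convexD simp: field_simps)
  qed
qed simp

text \<open>The least scale is attained: the pairs of a scale in \<open>{0..1}\<close> and a point
  of \<open>CH P\<close> that produce \<open>y\<close> form a compact set, nonempty since scale 1 is
  admissible.\<close>

lemma scaled_hull_least:
  assumes "y \<in> CH P"
  obtains d where "0 \<le> d" "d \<le> 1" "y \<in> scaled_hull d P"
    "\<And>d'. 0 \<le> d' \<Longrightarrow> y \<in> scaled_hull d' P \<Longrightarrow> d \<le> d'"
proof -
  let ?f = "\<lambda>(d, p). d *\<^sub>R p + (1 - d) *\<^sub>R gravity P"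
  let ?A = "({0..1} \<times> CH P) \<inter> ?f -` {y}"
  have "compact ({0..1 :: real} \<times> CH P)"
    by (intro compact_Times compact_Icc) (simp add: CH_def finite_imp_compact_convex_hull)
  moreover have "closed (?f -` {y})"
    by (intro closed_vimage) (auto intro!: continuous_intros simp: case_prod_beta)
  ultimately have "compact ?A"
    by (rule compact_Int_closed)
  moreover have "(1, y) \<in> ?A"
    using assms by simp
  then have "?A \<noteq> {}" by blast
  moreover have "continuous_on ?A fst"
    by (intro continuous_intros)
  ultimately have "\<exists>z\<in>?A. \<forall>w\<in>?A. fst z \<le> fst w"
    by (rule continuous_attains_inf)
  then obtain z where z: "z \<in> ?A" "\<And>w. w \<in> ?A \<Longrightarrow> fst z \<le> fst w"
    by blast
  show ?thesis
  proof
    show "0 \<le> fst z" "fst z \<le> 1"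
      using z(1) by (auto simp: case_prod_beta)
    show "y \<in> scaled_hull (fst z) P"
      using z(1) by (auto simp: scaled_hull_def case_prod_beta)
    show "fst z \<le> d'" if d': "0 \<le> d'" "y \<in> scaled_hull d' P" for d'
    proof (cases "d' \<le> 1")
      case True
      then obtain p where "(d', p) \<in> ?A"
        using d' by (auto simp: scaled_hull_def)
      then show ?thesis using z(2) by fastforce
    qed (use \<open>fst z \<le> 1\<close> in linarith)
  qed
qed

lemma alpha_at_eq:
  assumes "\<phi> P = Some y" "0 \<le> d" "y \<in> scaled_hull d P"
    and "\<And>d'. 0 \<le> d' \<Longrightarrow> y \<in> scaled_hull d' P \<Longrightarrow> d \<le> d'"
  shows "alpha_at \<phi> P = ennreal d"
proof -
  have "(LEAST d. 0 \<le> d \<and> y \<in> scaled_hull d P) = d"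
    using assms by (intro Least_equality) auto
  then show ?thesis
    using assms by (auto simp: alpha_at_def)
qed

text \<open>Every defined value lies in \<open>CH P\<close>, which bounds the scale by 1. A
  two-point configuration shows that 1 is reached.\<close>

lemma alpha_eq_1:
  assumes "selects \<phi> s"
  shows "alpha \<phi> = 1"
proof (rule antisym)
  have "alpha_at \<phi> P \<le> 1" if "size P = 4" for P
  proof (cases "\<phi> P")
    case None
    then show ?thesis by (simp add: alpha_at_def)
  next
    case (Some y)
    then have "0 \<in># P" "y = 0 \<or> Psi P \<and> y = s P \<or> y = gravity P"
      using assms unfolding selects_def by (metis option.distinct(1) option.inject)+
    moreover have "Psi P \<Longrightarrow> s P \<in># P"
      using assms by (simp add: selects_def)
    moreover from \<open>0 \<in># P\<close> have "P \<noteq> {#}" by auto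
    ultimately have "y \<in> CH P"
      using gravity_in_CH[of P] by (auto simp: CH_def intro: hull_inc)
    then obtain d where d: "0 \<le> d" "d \<le> 1" "y \<in> scaled_hull d P"
      "\<And>d'. 0 \<le> d' \<Longrightarrow> y \<in> scaled_hull d' P \<Longrightarrow> d \<le> d'"
      by (rule scaled_hull_least) blast
    have "alpha_at \<phi> P = ennreal d"
      using Some d(1,3,4) by (rule alpha_at_eq)
    then show ?thesis
      using ennreal_leI[OF d(2)] by simp
  qed
  then show "alpha \<phi> \<le> 1"
    unfolding alpha_def by (auto intro: SUP_least)
next
  define v :: point where "v = axis 1 1"
  \<comment> \<open>The value is \<open>0\<close>, an endpoint of the hull, whereas the center is
    \<open>(1 / 4) *\<^sub>R v\<close>; any scale below 1 pulls the hull away from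
    \<open>0\<close>.\<close>
  define P where "P = {#0, 0, 0, v#}"
  have "v \<noteq> 0" by (simp add: v_def axis_eq_0_iff)
  have g: "gravity P = (1 / 4) *\<^sub>R v"
    by (simp add: gravity_def P_def)
  have "set_mset P = {0, v}" by (auto simp: P_def)
  then have CH: "CH P = closed_segment 0 v"
    by (simp add: CH_def segment_convex_hull)
  have "\<phi> P = Some 0"
    using assms \<open>v \<noteq> 0\<close> unfolding selects_def by (simp add: P_def)
  moreover have "0 \<in> scaled_hull 1 P"
    by (auto simp: scaled_hull_def CH)
  moreover have "1 \<le> d" if d: "0 \<le> d" "0 \<in> scaled_hull d P" for d
  proof -
    obtain p where p: "p \<in> closed_segment 0 v" "0 = d *\<^sub>R p + (1 - d) *\<^sub>R gravity P"
      using d(2) unfolding scaled_hull_def CH by blast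
    then obtain c where c: "0 \<le> c" "p = c *\<^sub>R v"
      by (auto simp: in_segment)
    then have "(d * c + (1 - d) / 4) *\<^sub>R v = 0"
      using p(2) by (simp add: g scaleR_add_left)
    then have "d * c + (1 - d) / 4 = 0"
      using \<open>v \<noteq> 0\<close> by simp
    moreover have "0 \<le> d * c"
      using d(1) c(1) by simp
    ultimately have "(1 - d) / 4 \<le> 0"
      by (simp only: add_eq_0_iff)
    then show ?thesis
      by simp
  qed
  ultimately have "alpha_at \<phi> P = 1"
    using alpha_at_eq[of \<phi> P 0 1] by simp
  moreover have "size P = 4" by (simp add: P_def)
  ultimately show "1 \<le> alpha \<phi>"
    unfolding alpha_def by (intro SUP_upper2[of P]) auto
qed

subsection \<open>A deadlock of two nonfaulty robots\<close>

text \<open>The line where \<open>w\<close> takes the value \<open>c\<close> supports the hull: it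
  carries \<open>p\<close> and \<open>q\<close> and leaves \<open>r\<close> and \<open>s\<close>
  strictly on one side.\<close>

lemma closed_segment_edge_of_quadrilateral:
  fixes p q r s :: point
  assumes "w \<bullet> p = c" "w \<bullet> q = c" "w \<bullet> r > c" "w \<bullet> s > c" "p \<noteq> q"
  shows "closed_segment p q edge_of convex hull {p, q, r, s}"
proof -
  have "affine hull {p, q} \<subseteq> {z. w \<bullet> z = c}"
    using assms by (intro hull_minimal affine_hyperplane) auto
  moreover have "convex hull ({p, q, r, s} - {p, q}) \<subseteq> {z. w \<bullet> z > c}"
    using assms by (intro hull_minimal convex_halfspace_gt) auto
  ultimately have "affine hull {p, q} \<inter> convex hull ({p, q, r, s} - {p, q}) = {}"
    by fastforce
  then have "convex hull {p, q} face_of convex hull {p, q, r, s}"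
    by (intro face_of_convex_hulls) auto
  then show ?thesis
    using assms(5) by (simp add: edge_of_def segment_convex_hull aff_dim_convex_hull)
qed

text \<open>A face that meets the interior of the other diagonal contains that whole diagonal, in
  particular \<open>q\<close>.\<close>

lemma diagonal_not_edge_of:
  assumes "{p, q, r, s} \<subseteq> S" "z \<in> closed_segment p r" "z \<in> open_segment q s"
    "q \<notin> closed_segment p r"
  shows "\<not> closed_segment p r edge_of convex hull S"
proof
  assume "closed_segment p r edge_of convex hull S"
  then have "closed_segment p r face_of convex hull S"
    by (simp add: edge_of_def)
  moreover have "q \<in> convex hull S" "s \<in> convex hull S"
    using assms(1) by (auto intro: hull_inc)
  ultimately show False
    using assms(2-4) unfolding face_of_def by blast
qed

lemma extreme_point_of_hull_if_separated:
  fixes p :: point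
  assumes "finite S" "p \<in> S" "\<And>q. q \<in> S - {p} \<Longrightarrow> w \<bullet> q > w \<bullet> p"
  shows "p extreme_point_of convex hull S"
proof -
  have "convex hull (S - {p}) \<subseteq> {z. w \<bullet> z > w \<bullet> p}"
    using assms by (intro hull_minimal convex_halfspace_gt) auto
  then have "p \<notin> convex hull (S - {p})" by auto
  then have "p extreme_point_of convex hull (insert p (S - {p}))"
    using assms(1) by (intro extreme_point_of_convex_hull_insert) auto
  then show ?thesis
    using assms(2) by (simp add: insert_absorb)
qed

lemma angle_commute: "angle q p r = angle r p q"
  by (simp add: angle_def inner_commute mult.commute)

text \<open>The description determines one value: only \<open>q\<close> and \<open>r\<close> can be
  the neighbours of \<open>p\<close>, and exchanging them does not change the angle.\<close>

lemma vertex_angle_eq: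
  assumes "S = {p, q, r, s}" "q \<noteq> r"
    and "closed_segment p q edge_of convex hull S" "closed_segment p r edge_of convex hull S"
    and "\<not> closed_segment p s edge_of convex hull S"
  shows "vertex_angle S p = angle q p r"
  unfolding vertex_angle_def
proof (rule the_equality)
  show "\<exists>q'\<in>S. \<exists>r'\<in>S. q' \<noteq> r' \<and> closed_segment p q' edge_of convex hull S \<and>
      closed_segment p r' edge_of convex hull S \<and> angle q p r = angle q' p r'"
    using assms by blast
next
  fix \<theta>
  assume "\<exists>q'\<in>S. \<exists>r'\<in>S. q' \<noteq> r' \<and> closed_segment p q' edge_of convex hull S \<and>
      closed_segment p r' edge_of convex hull S \<and> \<theta> = angle q' p r'"
  then obtain q' r' where *: "q' \<in> S" "r' \<in> S" "q' \<noteq> r'"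
    "closed_segment p q' edge_of convex hull S" "closed_segment p r' edge_of convex hull S"
    "\<theta> = angle q' p r'"
    by blast
  \<comment> \<open>A degenerate segment has dimension 0 and is no edge.\<close>
  have "\<not> closed_segment p p edge_of convex hull S"
    by (simp add: edge_of_def)
  then have "q' \<in> {q, r}" "r' \<in> {q, r}"
    using * assms(1,5) by auto
  then show "\<theta> = angle q p r"
    using *(3,6) angle_commute by auto
qed

text \<open>Cauchy-Schwarz puts both quotients into the range where \<open>arccos\<close> is
  strictly decreasing.\<close>

lemma angle_less:
  assumes "((q' - p') \<bullet> (r' - p')) / (norm (q' - p') * norm (r' - p')) <
    ((q - p) \<bullet> (r - p)) / (norm (q - p) * norm (r - p))"
  shows "angle q p r < angle q' p' r'"
proof -
  have "\<bar>v \<bullet> w / (norm v * norm w)\<bar> \<le> 1" for v w :: point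
    using Cauchy_Schwarz_ineq2[of v w]
    by (cases "norm v * norm w = 0") (auto simp: abs_divide divide_le_eq_1 abs_mult)
  then show ?thesis
    unfolding angle_def using assms by (subst arccos_less_mono) auto
qed

text \<open>The constant hull would have Hausdorff distance 0 to a segment between two robots. Every
  vertex would then be an extreme point of that segment, leaving at most two vertices.\<close>

lemma static_quadrilateral_not_converging:
  assumes "convex_quadrilateral (range X)"
  shows "\<not> converges_to_segment (\<lambda>t. X)"
proof
  assume "converges_to_segment (\<lambda>t. X)"
  then obtain a b i j where "(\<lambda>t::nat. hausdorff_dist (CH (config X)) (closed_segment a b)) \<longlonglongrightarrow> 0"
    "(\<lambda>t::nat. X i) \<longlonglongrightarrow> a" "(\<lambda>t::nat. X j) \<longlonglongrightarrow> b"
    unfolding converges_to_segment_def by blast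
  then have h: "hausdorff_dist (convex hull (range X)) (closed_segment (X i) (X j)) = 0"
    by (simp add: LIMSEQ_const_iff CH_def)
  let ?K = "closed_segment (X i) (X j)"
  have "compact ((\<lambda>p. infdist p ?K) ` (convex hull (range X)))"
    by (intro compact_continuous_image continuous_intros finite_imp_compact_convex_hull) auto
  then have bdd: "bdd_above ((\<lambda>p. infdist p ?K) ` (convex hull (range X)))"
    by (intro bounded_imp_bdd_above compact_imp_bounded)
  have "range X \<subseteq> {X i, X j}"
  proof
    fix p assume p: "p \<in> range X"
    then have "p \<in> convex hull (range X)" by (rule hull_inc)
    then have "infdist p ?K \<le> (SUP p\<in>convex hull (range X). infdist p ?K)"
      using bdd by (rule cSUP_upper)
    also have "\<dots> \<le> 0"
      using h unfolding hausdorff_dist_def by linarith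
    finally have "p \<in> ?K"
      using infdist_nonneg[of p ?K] in_closed_iff_infdist_zero[of ?K p] by simp
    moreover have "p extreme_point_of convex hull (range X)"
      using assms p by (auto simp: convex_quadrilateral_def)
    moreover have "?K \<subseteq> convex hull (range X)"
      unfolding segment_convex_hull by (intro hull_mono) auto
    ultimately have "p extreme_point_of convex hull {X i, X j}"
      unfolding extreme_point_of_def segment_convex_hull by blast
    then show "p \<in> {X i, X j}"
      by (rule extreme_point_of_convex_hull)
  qed
  then have "card (range X) \<le> card {X i, X j}"
    by (intro card_mono) auto
  also have "\<dots> \<le> 2"
    by (simp add: card_insert_if)
  finally show False
    using assms by (simp add: convex_quadrilateral_def)
qed

text \<open>An explicit quadrilateral: the cosines at \<open>B\<close>, \<open>C\<close>,
  \<open>A\<close>, \<open>D\<close> are \<open>2 / sqrt 13\<close>,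
  \<open>4 / (sqrt 5 * sqrt 13)\<close>, \<open>0\<close> and \<open>- 2 / sqrt 5\<close>, in
  decreasing order.\<close>

lemma ex_Psi_labelling:
  obtains p1 p2 p3 p4 where "Psi_labelling {#p1, p2, p3, p4#} p1 p2 p3 p4"
proof -
  define A B C D :: point where
    pts: "A = vector [0, 0]" "B = vector [3, 0]" "C = vector [1, 3]" "D = vector [0, 1]"
  define S where "S = {A, B, C, D}"
  note coord = pts inner_vec_def sum_2 vec_eq_iff forall_2
  have distinct: "A \<noteq> B" "A \<noteq> C" "A \<noteq> D" "B \<noteq> C" "B \<noteq> D" "C \<noteq> D"
    by (simp_all add: coord)
  \<comment> \<open>Here and for the other three sides, \<open>w\<close> is an inner normal of the
    side.\<close>
  have "closed_segment A B edge_of convex hull {A, B, C, D}"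
    by (rule closed_segment_edge_of_quadrilateral[where w = "vector [0, 1]" and c = 0])
      (simp_all add: coord)
  then have AB: "closed_segment A B edge_of convex hull S"
    by (simp add: S_def)
  have "closed_segment B C edge_of convex hull {B, C, A, D}"
    by (rule closed_segment_edge_of_quadrilateral[where w = "vector [-3, -2]" and c = "-9"])
      (simp_all add: coord)
  then have BC: "closed_segment B C edge_of convex hull S"
    by (simp add: S_def insert_commute)
  have "closed_segment C D edge_of convex hull {C, D, A, B}"
    by (rule closed_segment_edge_of_quadrilateral[where w = "vector [2, -1]" and c = "-1"])
      (simp_all add: coord)
  then have CD: "closed_segment C D edge_of convex hull S"
    by (simp add: S_def insert_commute)
  have "closed_segment D A edge_of convex hull {D, A, B, C}"
    by (rule closed_segment_edge_of_quadrilateral[where w = "vector [1, 0]" and c = 0])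
      (simp_all add: coord)
  then have DA: "closed_segment D A edge_of convex hull S"
    by (simp add: S_def insert_commute)
  \<comment> \<open>\<open>Z\<close> is the intersection of the two diagonals.\<close>
  define Z :: point where "Z = vector [3 / 10, 9 / 10]"
  have Z: "Z \<in> open_segment A C" "Z \<in> open_segment B D"
    unfolding in_segment
    by (intro conjI exI[of _ "3 / 10"]; simp add: coord Z_def)
      (intro conjI exI[of _ "9 / 10"]; simp add: coord Z_def)
  then have Z': "Z \<in> closed_segment A C" "Z \<in> closed_segment B D"
    by (auto simp: open_segment_def)
  have "B \<notin> closed_segment A C" "A \<notin> closed_segment B D"
    by (auto simp: in_segment coord)
  then have AC: "\<not> closed_segment A C edge_of convex hull S"
    and BD: "\<not> closed_segment B D edge_of convex hull S"
    using diagonal_not_edge_of[of A B C D S Z] diagonal_not_edge_of[of B A D C S Z] Z Z'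
    by (auto simp: S_def)
  \<comment> \<open>Items 7 to 12 are items 1 to 6 with reversed segments, because each segment must
    start at the vertex whose angle is computed.\<close>
  note edges = AB BC CD DA AC BD
    AB[unfolded closed_segment_commute[of A]] BC[unfolded closed_segment_commute[of B]]
    CD[unfolded closed_segment_commute[of C]] DA[unfolded closed_segment_commute[of D]]
    AC[unfolded closed_segment_commute[of A]] BD[unfolded closed_segment_commute[of B]]
  have angles: "vertex_angle S A = angle B A D" "vertex_angle S B = angle A B C"
    "vertex_angle S C = angle B C D" "vertex_angle S D = angle A D C"
    by (rule vertex_angle_eq[OF _ _ edges(1) edges(10) edges(5)]
        vertex_angle_eq[OF _ _ edges(7) edges(2) edges(6)]
        vertex_angle_eq[OF _ _ edges(8) edges(3) edges(11)]
        vertex_angle_eq[OF _ _ edges(4) edges(9) edges(12)];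
        use distinct in \<open>auto simp: S_def\<close>)+
  have "4 / sqrt 5 < (2::real)"
    using real_less_rsqrt[of 2 5] by (simp add: pos_divide_less_eq)
  then have "4 / sqrt 5 / sqrt 13 < 2 / sqrt 13"
    by (rule divide_strict_right_mono) simp
  then have "angle A B C < angle B C D"
    by (intro angle_less) (simp add: norm_eq_sqrt_inner coord mult.commute)
  moreover have "angle B C D < angle B A D"
    by (rule angle_less) (simp add: norm_eq_sqrt_inner coord)
  moreover have "angle B A D < angle A D C"
    by (rule angle_less) (simp add: norm_eq_sqrt_inner coord)
  moreover have "convex_quadrilateral S"
  proof -
    have "A extreme_point_of convex hull S"
      by (rule extreme_point_of_hull_if_separated[where w = "vector [1, 1]"])
        (auto simp: S_def coord)
    moreover have "B extreme_point_of convex hull S"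
      by (rule extreme_point_of_hull_if_separated[where w = "vector [-1, 0]"])
        (auto simp: S_def coord)
    moreover have "C extreme_point_of convex hull S"
      by (rule extreme_point_of_hull_if_separated[where w = "vector [0, -1]"])
        (auto simp: S_def coord)
    moreover have "D extreme_point_of convex hull S"
      by (rule extreme_point_of_hull_if_separated[where w = "vector [3, -1]"])
        (auto simp: S_def coord)
    ultimately show ?thesis
      using distinct by (simp add: convex_quadrilateral_def S_def)
  qed
  ultimately have "Psi_labelling {#B, C, A, D#} B C A D"
    unfolding Psi_labelling_def using angles by (simp add: S_def insert_commute)
  then show ?thesis using that by blast
qed

lemma not_compatible_tau_tau': "\<not> compatible ({tau} \<union> {tau'})"
proof
  assume compatible: "compatible ({tau} \<union> {tau'})"
  obtain p1 p2 p3 p4 where lab: "Psi_labelling {#p1, p2, p3, p4#} p1 p2 p3 p4"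
    by (rule ex_Psi_labelling)
  define X :: "4 \<Rightarrow> point" where
    "X i = (if i = 1 then p1 else if i = 2 then p2 else if i = 3 then p3 else p4)" for i
  have config: "config X = {#p1, p2, p3, p4#}"
    unfolding config_def UNIV_4 by (simp add: X_def)
  have Psi: "Psi (config X)"
    unfolding Psi_def config using lab by blast
  have quad: "convex_quadrilateral (range X)"
    using Psi_convex_quadrilateral[OF Psi] by simp
  then have four: "card (range X) = 4"
    by (simp add: convex_quadrilateral_def)
  define \<phi> where "\<phi> i = (if i = 1 then tau else tau')" for i :: 4
  \<comment> \<open>Robots 2 and 3 crash at time 0, before any move; robots 1 and 4 are their own
    targets.\<close>
  define crash :: "4 \<Rightarrow> enat" where "crash i = (if i = 1 \<or> i = 4 then \<infinity> else 0)" for i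
  have rot: "rotation_matrix (mat 1 :: real^2^2)"
    by (simp add: rotation_matrix_def orthogonal_matrix_id)
  have stay: "Some (X i) = map_option (to_global 1 (mat 1) (X i))
      (\<phi> i (image_mset (inv (to_global 1 (mat 1) (X i))) (config X)))" if "i = 1 \<or> i = 4" for i
    using that
  proof
    assume "i = 1"
    have "Psi_first (config X) = X 1"
      using Psi_first_eq[OF lab] by (simp add: config X_def)
    then show ?thesis
      using selects_global[OF selects_tau _ rot, of 1 "X 1" "config X"] Psi four
      by (simp add: \<phi>_def \<open>i = 1\<close> del: map_option_eq_Some)
  next
    assume "i = 4"
    have "Psi_last (config X) = X 4"
      using Psi_last_eq[OF lab] by (simp add: config X_def)
    then show ?thesis
      using selects_global[OF selects_tau' _ rot, of 1 "X 4" "config X"] Psi four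
      by (simp add: \<phi>_def \<open>i = 4\<close> del: map_option_eq_Some)
  qed
  have "{i. crash i \<noteq> \<infinity>} = {2, 3}"
    using exhaust_4 by (auto simp: crash_def zero_enat_def)
  then have "card {i. crash i \<noteq> \<infinity>} \<le> 2"
    by simp
  moreover have "execution \<phi> (\<lambda>_. 1) (\<lambda>_. mat 1) (\<lambda>_. UNIV) crash (\<lambda>_. X)"
    unfolding execution_def Let_def using stay by (simp add: crash_def zero_enat_def)
  moreover have "fair (\<lambda>_. UNIV)"
    by (simp add: fair_def INFM_nat_le)
  moreover have "\<forall>i. \<phi> i \<in> {tau} \<union> {tau'}"
    by (simp add: \<phi>_def)
  moreover have "\<forall>i::4. (1::real) > 0 \<and> rotation_matrix (mat 1 :: real^2^2)"
    using rot by simp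
  ultimately have "converges_to_segment (\<lambda>_. X)"
    using compatible[unfolded compatible_def, rule_format,
        where \<phi> = \<phi> and u = "\<lambda>_. 1" and R = "\<lambda>_. mat 1" and act = "\<lambda>_. UNIV"
          and crash = crash and x = "\<lambda>_. X"]
    by blast
  then show False
    using static_quadrilateral_not_converging[OF quad] by blast
qed

theorem theorem9:
  shows "alpha_set {tau} = 1 \<and> alpha_set {tau'} = 1 \<and>
         compatible {tau} \<and> compatible {tau'} \<and>
         \<not> compatible ({tau} \<union> {tau'})"
  using alpha_eq_1[OF selects_tau] alpha_eq_1[OF selects_tau']
    compatible_singleton[OF selects_tau] compatible_singleton[OF selects_tau']
    not_compatible_tau_tau'
  by (simp add: alpha_set_def)

end
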